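(* Let $d\ge1$ be an integer, and consider the parking model on $\mathbb{Z}^d$ with parameter $p\in[0,1]$, law $\mathbb{P}_p$ and expectation $\mathbb{E}_p$. Let $V\in\{0,1,2,\dots\}\cup\{\infty\}$ be the total number of visits to the origin by cars over all time. Then for all $p\in[0,1]$, \[ \mathbb{E}_p V\ \ge\ p+p^2 , \] and, as $p\to0$, \[ \mathbb{E}_p V = p+O\left(p^2\left(\log p^{-1}\right)^{(d+2)/d}\right), \] where the constant in the $O$ term depends on $d$.
   Context: Parking model on $\mathbb{Z}^d$ with parameter $p\in[0,1]$. The probability space is $\Omega=\left(\{-1,1\}\times(\mathbb{Z}^d)^{\mathbb{N}}\times[0,1]^{\mathbb{N}}\right)^{\mathbb{Z}^d}$ with a probability measure $\mathbb{P}_p$ under which the following are all independent, over all vertices $v\in\mathbb{Z}^d$ and over the three components at each $v$: (1) a variable equal to $1$ with probability $p$ (a car is initially at $v$) and $-1$ with probability $1-p$ (there is initially a vacant parking spot at $v$, and no car); (2) a discrete-time simple symmetric random walk path on $\mathbb{Z}^d$ started at $v$ (each step is to a uniformly chosen nearest neighbor), which is the path followed by the car starting at $v$ (if any) as long as it is unparked; (3) a sequence $(U^{(v)}_t)_t$ of i.i.d. uniform $[0,1]$ random variables used to break ties. Dynamics: at time $0$ all cars are unparked. At each time $t=1,2,\dots$, every car that is unparked at time $t-1$ simultaneously moves to the time-$t$ position of its random walk path. If at time $t$ at least one such car arrives at a vertex with a vacant parking spot, then exactly one of the arriving cars parks there at time $t$ (the one with the largest tie-breaking uniform variable of index $t$),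 and stays there forever; that spot is occupied from then on. Unparked cars arriving at any other vertex (an occupied spot, or a vertex that initially held a car and hence has no parking spot), and arriving cars that lose the tie-break, do not park and continue moving at the next time step. Visits: a car visits $x$ at time $t\ge1$ if it is unparked at time $t-1$ and moves to $x$ at time $t$ (it may or may not park at $x$). Each time a car visits $x$ counts as one visit; multiple cars visiting at the same time, and the same car visiting at several times, are all counted as distinct visits. Let $V_t$ be the number of visits by all cars to the origin through time $t$ (so $V_0=0$), and $V=\lim_{t\to\infty}V_t$. *)

theory Defs
  imports "HOL-Probability.Probability" "HOL-Library.Landau_Symbols"
begin

text \<open>
  The lattice \<open>\<int>\<^sup>d\<close> is \<^typ>\<open>int ^ 'd\<close>, so that \<open>d = CARD('d)\<close>.
  A configuration attaches to every site the initial marker (\<open>1\<close>: a car, \<open>-1\<close>: a vacant spot),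
  the random walk path, and the sequence of tie-breaking variables.
\<close>

type_synonym 'd site = "int ^ 'd"
type_synonym 'd config = "'d site \<Rightarrow> int \<times> (nat \<Rightarrow> 'd site) \<times> (nat \<Rightarrow> real)"

definition marker :: "('d::finite) config \<Rightarrow> 'd site \<Rightarrow> int" where
  "marker \<omega> v = fst (\<omega> v)"

definition walk :: "('d::finite) config \<Rightarrow> 'd site \<Rightarrow> nat \<Rightarrow> 'd site" where
  "walk \<omega> v = fst (snd (\<omega> v))"

definition tiebreak :: "('d::finite) config \<Rightarrow> 'd site \<Rightarrow> nat \<Rightarrow> real" where
  "tiebreak \<omega> v = snd (snd (\<omega> v))"

definition marker_pmf :: "real \<Rightarrow> int pmf" where
  "marker_pmf p = map_pmf (\<lambda>b. if b then 1 else -1) (bernoulli_pmf p)"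

definition unit_steps :: "('d::finite) site set" where
  "unit_steps = range (\<lambda>i. axis i 1) \<union> range (\<lambda>i. axis i (-1))"

definition srw_measure :: "('d::finite) site \<Rightarrow> (nat \<Rightarrow> 'd site) measure" where
  "srw_measure v =
     distr (\<Pi>\<^sub>M t\<in>UNIV. measure_pmf (pmf_of_set unit_steps))
           (\<Pi>\<^sub>M t\<in>UNIV. count_space UNIV)
           (\<lambda>\<xi> t. v + (\<Sum>s<t. \<xi> s))"

definition tiebreak_measure :: "(nat \<Rightarrow> real) measure" where
  "tiebreak_measure = (\<Pi>\<^sub>M t\<in>UNIV. uniform_measure lborel {0..1})"

definition parking_measure :: "real \<Rightarrow> ('d::finite) config measure" where
  "parking_measure p =
     (\<Pi>\<^sub>M v\<in>UNIV. measure_pmf (marker_pmf p) \<Otimes>\<^sub>M (srw_measure v \<Otimes>\<^sub>M tiebreak_measure))"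

text \<open>
  Given the set \<open>A\<close> of origins of unparked cars and the set \<open>S\<close> of vacant spots just before time
  \<open>t\<close>, the cars (identified with their origins) that park at time \<open>t\<close>. The winner of a tie-break
  has to beat all other arriving cars strictly; ties, as well as infinitely many cars arriving at
  the same site, only occur on a null set.
\<close>

definition parkers ::
  "('d::finite) config \<Rightarrow> nat \<Rightarrow> 'd site set \<Rightarrow> 'd site set \<Rightarrow> 'd site set" where
  "parkers \<omega> t A S =
     {v \<in> A. walk \<omega> v t \<in> S \<and>
        (\<forall>w\<in>A. w \<noteq> v \<and> walk \<omega> w t = walk \<omega> v t \<longrightarrow> tiebreak \<omega> w t < tiebreak \<omega> v t)}"

text \<open>The pair of the set of origins of unparked cars and the set of vacant spots at a given time.\<close>

primrec parking_state :: "('d::finite) config \<Rightarrow> nat \<Rightarrow> 'd site set \<times> 'd site set" where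
  "parking_state \<omega> 0 = ({v. marker \<omega> v = 1}, {v. marker \<omega> v = -1})"
| "parking_state \<omega> (Suc t) =
     (let (A, S) = parking_state \<omega> t; P = parkers \<omega> (Suc t) A S
      in (A - P, S - (\<lambda>v. walk \<omega> v (Suc t)) ` P))"

definition unparked :: "('d::finite) config \<Rightarrow> nat \<Rightarrow> 'd site set" where
  "unparked \<omega> t = fst (parking_state \<omega> t)"

text \<open>A visit to the origin is a pair of its time and (the origin of) the visiting car.\<close>

definition visits_until :: "('d::finite) config \<Rightarrow> nat \<Rightarrow> ennreal" where
  "visits_until \<omega> t =
     emeasure (count_space UNIV) {(s, v). 1 \<le> s \<and> s \<le> t \<and> v \<in> unparked \<omega> (s - 1) \<and> walk \<omega> v s = 0}"

definition total_visits :: "('d::finite) config \<Rightarrow> ennreal" where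
  "total_visits \<omega> = lim (visits_until \<omega>)"

definition expected_visits :: "('d::finite) itself \<Rightarrow> real \<Rightarrow> ennreal" where
  "expected_visits _ p = (\<integral>\<^sup>+ \<omega>. total_visits (\<omega> :: 'd config) \<partial>parking_measure p)"

lemma visits_until_tendsto: "visits_until \<omega> \<longlonglongrightarrow> total_visits \<omega>"
proof -
  have "incseq (visits_until \<omega>)"
    unfolding visits_until_def by (intro incseq_SucI emeasure_mono) auto
  then have "convergent (visits_until \<omega>)"
    using LIMSEQ_SUP convergentI by blast
  then show ?thesis
    by (simp add: total_visits_def convergent_LIMSEQ_iff)
qed

lemma prob_space_srw_measure: "prob_space (srw_measure v)"
proof -
  interpret product_prob_space "\<lambda>_::nat. measure_pmf (pmf_of_set unit_steps)" UNIV ..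
  show ?thesis
    unfolding srw_measure_def
  proof (intro prob_space_distr measurable_PiM_single')
    fix t :: nat
    have "(\<lambda>\<xi>. v + (\<Sum>s<t. \<xi> s)) \<in>
        (\<Pi>\<^sub>M t\<in>UNIV. measure_pmf (pmf_of_set unit_steps)) \<rightarrow>\<^sub>M count_space UNIV"
    proof (induction t)
      case (Suc t)
      have "(\<lambda>(x, y). x + y) \<in> count_space UNIV \<Otimes>\<^sub>M count_space UNIV \<rightarrow>\<^sub>M count_space (UNIV :: (int ^ 'a) set)"
        by (simp add: pair_measure_countable)
      moreover have "(\<lambda>\<xi>. \<xi> t) \<in>
        (\<Pi>\<^sub>M t\<in>UNIV. measure_pmf (pmf_of_set unit_steps)) \<rightarrow>\<^sub>M count_space (UNIV :: (int ^ 'a) set)"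
        by (metis UNIV_I measurable_component_singleton measurable_pmf_measure2 sets_measure_pmf_count_space measurable_cong_sets)
      ultimately have "(\<lambda>\<xi>. case (v + (\<Sum>s<t. \<xi> s), \<xi> t) of (x, y) \<Rightarrow> x + y) \<in>
        (\<Pi>\<^sub>M t\<in>UNIV. measure_pmf (pmf_of_set unit_steps)) \<rightarrow>\<^sub>M count_space UNIV"
        by (intro measurable_compose[OF measurable_Pair[OF Suc]])
      then show ?case by (simp add: add.assoc)
    qed simp
    then show "(\<lambda>\<xi>. v + (\<Sum>s<t. \<xi> s)) \<in>
        (\<Pi>\<^sub>M t\<in>UNIV. measure_pmf (pmf_of_set unit_steps)) \<rightarrow>\<^sub>M count_space UNIV" .
  qed auto
qed

lemma prob_space_tiebreak_measure: "prob_space tiebreak_measure"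
  unfolding tiebreak_measure_def
  by (intro prob_space_PiM prob_space_uniform_measure) auto

lemma prob_space_parking_measure: "prob_space (parking_measure p)"
  unfolding parking_measure_def
  by (intro prob_space_PiM prob_space_pair prob_space_srw_measure prob_space_tiebreak_measure
        measure_pmf.prob_space_axioms)

lemma measurable_total_visits: "total_visits \<in> borel_measurable (parking_measure p)"
proof -
  let ?M = "parking_measure p :: 'a config measure"
  have comp: "(\<lambda>\<omega>. \<omega> v) \<in> ?M \<rightarrow>\<^sub>M
      measure_pmf (marker_pmf p) \<Otimes>\<^sub>M (srw_measure v \<Otimes>\<^sub>M tiebreak_measure)" for v
    unfolding parking_measure_def by (rule measurable_component_singleton) simp
  have [measurable]: "(\<lambda>\<omega>. marker \<omega> v) \<in> ?M \<rightarrow>\<^sub>M count_space UNIV" for v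
    using measurable_compose[OF comp measurable_fst] by (simp add: marker_def)
  have [measurable]: "(\<lambda>\<omega>. walk \<omega> v t) \<in> ?M \<rightarrow>\<^sub>M count_space UNIV" for v t
  proof -
    have "(\<lambda>\<xi>. \<xi> t) \<in> srw_measure v \<rightarrow>\<^sub>M count_space UNIV"
      unfolding srw_measure_def measurable_distr_eq1 by (rule measurable_component_singleton) simp
    then show ?thesis unfolding walk_def
      by (rule measurable_compose[OF measurable_compose[OF measurable_compose[OF comp measurable_snd] measurable_fst]])
  qed
  have [measurable]: "(\<lambda>\<omega>. tiebreak \<omega> v t) \<in> borel_measurable ?M" for v t
  proof -
    have "(\<lambda>\<xi>. \<xi> t) \<in> tiebreak_measure \<rightarrow>\<^sub>M uniform_measure lborel {0..1}"
      unfolding tiebreak_measure_def by (rule measurable_component_singleton) simp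
    then have "(\<lambda>\<xi>. \<xi> t) \<in> tiebreak_measure \<rightarrow>\<^sub>M borel"
      by (simp cong: measurable_cong_sets)
    then show ?thesis unfolding tiebreak_def
      by (rule measurable_compose[OF measurable_compose[OF measurable_compose[OF comp measurable_snd] measurable_snd]])
  qed
  have state: "(\<forall>v. Measurable.pred ?M (\<lambda>\<omega>. v \<in> fst (parking_state \<omega> t))) \<and>
      (\<forall>x. Measurable.pred ?M (\<lambda>\<omega>. x \<in> snd (parking_state \<omega> t)))" for t
  proof (induction t)
    case 0
    then show ?case by simp
  next
    case (Suc t)
    define A where "A \<omega> = fst (parking_state \<omega> t)" for \<omega> :: "'a config"
    define S where "S \<omega> = snd (parking_state \<omega> t)" for \<omega> :: "'a config"
    have [measurable]: "Measurable.pred ?M (\<lambda>\<omega>. v \<in> A \<omega>)" "Measurable.pred ?M (\<lambda>\<omega>. v \<in> S \<omega>)" for v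
      using Suc by (auto simp: A_def S_def)
    have S_walk: "walk \<omega> v (Suc t) \<in> S \<omega> \<longleftrightarrow> (\<exists>x. walk \<omega> v (Suc t) = x \<and> x \<in> S \<omega>)" for \<omega> v
      by simp
    have [measurable]: "Measurable.pred ?M (\<lambda>\<omega>. v \<in> parkers \<omega> (Suc t) (A \<omega>) (S \<omega>))" for v
      unfolding parkers_def mem_Collect_eq S_walk Ball_def by measurable
    have "fst (parking_state \<omega> (Suc t)) = A \<omega> - parkers \<omega> (Suc t) (A \<omega>) (S \<omega>)"
      and "snd (parking_state \<omega> (Suc t)) =
        {x \<in> S \<omega>. \<forall>v. v \<in> parkers \<omega> (Suc t) (A \<omega>) (S \<omega>) \<longrightarrow> walk \<omega> v (Suc t) \<noteq> x}" for \<omega>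
      by (auto simp: A_def S_def Let_def split: prod.splits)
    then show ?case by simp
  qed
  have [measurable]: "Measurable.pred ?M (\<lambda>\<omega>. v \<in> unparked \<omega> t)" for v t
    using state by (simp add: unparked_def)
  have "(\<lambda>\<omega>. visits_until \<omega> t) \<in> borel_measurable ?M" for t
  proof -
    let ?Q = "\<lambda>\<omega> x. 1 \<le> fst x \<and> fst x \<le> t \<and> snd x \<in> unparked \<omega> (fst x - 1) \<and> walk \<omega> (snd x) (fst x) = 0"
    interpret sigma_finite_measure "count_space (UNIV :: (nat \<times> 'a site) set)"
      by (rule sigma_finite_measure_count_space_countable) simp
    have "visits_until \<omega> t = (\<integral>\<^sup>+ x. of_bool (?Q \<omega> x) \<partial>count_space UNIV)" for \<omega> :: "'a config"
    proof -
      have "visits_until \<omega> t = (\<integral>\<^sup>+ x. indicator {x. ?Q \<omega> x} x \<partial>count_space UNIV)"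
        unfolding visits_until_def by (simp add: split_beta')
      also have "\<dots> = (\<integral>\<^sup>+ x. of_bool (?Q \<omega> x) \<partial>count_space UNIV)"
        by (intro nn_integral_cong) (auto simp: indicator_def)
      finally show ?thesis .
    qed
    moreover have "(\<lambda>\<omega>. \<integral>\<^sup>+ x. of_bool (?Q \<omega> x) \<partial>count_space UNIV) \<in> borel_measurable ?M"
    proof (rule borel_measurable_nn_integral)
      let ?f = "\<lambda>x z. of_bool (?Q (fst z) x) :: ennreal"
      have "(\<lambda>\<omega>. of_bool (?Q \<omega> x) :: ennreal) \<in> borel_measurable ?M" for x
        by measurable
      then have "?f x \<in> borel_measurable (?M \<Otimes>\<^sub>M count_space UNIV)" for x
        using measurable_compose[OF measurable_fst] by blast
      then have "(\<lambda>z. ?f (snd z) z) \<in> borel_measurable (?M \<Otimes>\<^sub>M count_space UNIV)"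
        by (rule measurable_compose_countable'[where I = UNIV]) simp_all
      then show "(\<lambda>(\<omega>, x). of_bool (?Q \<omega> x) :: ennreal) \<in> borel_measurable (?M \<Otimes>\<^sub>M count_space UNIV)"
        by (simp add: split_beta')
    qed
    ultimately show ?thesis by simp
  qed
  then show ?thesis
    by (rule borel_measurable_LIMSEQ_order[OF visits_until_tendsto])
qed

end

theory Submission imports Defs begin

text \<open>
  Trace back how the spots visited by a car \<open>v\<close> that is still unparked at time \<open>t\<close> came to be
  occupied, then how the cars occupying them came to get there, and so on. The sites met form a
  finite connected set \<open>A\<close> that contains the trajectory of \<open>v\<close> up to time \<open>t\<close> and each of whose
  spots is filled by a car from \<open>A\<close> other than \<open>v\<close>; hence more than half of the sites of \<open>A\<close> are
  cars. The markers are independent of the walk of \<open>v\<close>, so a union bound over \<open>A\<close> and over its set \<open>F\<close>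
  of cars gives terms \<open>p ^ card F\<close> times the probability that the walk has not left \<open>A\<close>. Summing
  over the starting point \<open>v\<close> removes the constraint that the walk is at the origin, and summing
  over time yields the mean exit time from \<open>A\<close>, which is at most exponential in \<open>card A\<close>. As there are
  only exponentially many \<open>A\<close> of a given size, and \<open>card F \<ge> 2\<close> whenever \<open>t \<ge> 1\<close>, the visits after
  time 1 contribute \<open>O(p\<^sup>2)\<close>; this is stronger than the bound with the logarithm.
  The lower bound counts the visits at time 1 and those at time 2 by cars whose first step
  leads to a site that held a car.
\<close>

subsection \<open>Lattice animals\<close>

lemma finite_unit_steps: "finite (unit_steps :: ('d::finite) site set)"
  by (simp add: unit_steps_def)

lemma axis_in_unit_steps: "axis i 1 \<in> (unit_steps :: ('d::finite) site set)"
  by (simp add: unit_steps_def)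

lemma unit_steps_nonempty: "(unit_steps :: ('d::finite) site set) \<noteq> {}"
  using axis_in_unit_steps by auto

lemma uminus_unit_steps: "e \<in> unit_steps \<Longrightarrow> - e \<in> (unit_steps :: ('d::finite) site set)"
proof -
  have "- axis i a = (axis i (- a) :: 'd site)" for i and a :: int
    by (simp add: vec_eq_iff axis_def)
  then show "e \<in> unit_steps \<Longrightarrow> - e \<in> (unit_steps :: 'd site set)"
    by (auto simp: unit_steps_def)
qed

lemma zero_notin_unit_steps: "0 \<notin> (unit_steps :: ('d::finite) site set)"
proof
  assume "0 \<in> (unit_steps :: 'd site set)"
  then obtain i :: 'd and a :: int where "a \<noteq> 0" "axis i a = (0 :: 'd site)"
    by (auto simp: unit_steps_def)
  then show False
    by (metis axis_nth zero_index)
qed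

text \<open>Finite connected sets of sites containing the root, grown one neighbour at a time. In
  \<open>step\<close> the site \<open>x\<close> may already lie in \<open>A\<close>, so unions of
  overlapping animals need no case distinction.\<close>

inductive animal :: "('d::finite) site \<Rightarrow> 'd site set \<Rightarrow> bool" for v where
  root: "animal v {v}"
| step: "animal v A \<Longrightarrow> y \<in> A \<Longrightarrow> x - y \<in> unit_steps \<Longrightarrow> animal v (insert x A)"

lemma animal_finite: "animal v A \<Longrightarrow> finite A"
  by (induction rule: animal.induct) auto

lemma animal_root: "animal v A \<Longrightarrow> v \<in> A"
  by (induction rule: animal.induct) auto

text \<open>The growth of \<open>B\<close> from its root \<open>y\<close> can be replayed on top of
  \<open>A\<close>: \<open>y\<close> is adjacent to \<open>z \<in> A\<close>, and each later site of
  \<open>B\<close> has its neighbour in \<open>A \<union> B\<close> already.\<close>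

lemma animal_Un:
  assumes "animal y B" "animal v A" "z \<in> A" "y - z \<in> unit_steps"
  shows "animal v (A \<union> B)"
  using assms
proof (induction rule: animal.induct)
  case root
  then show ?case using animal.step by fastforce
next
  case (step B b x)
  then have "animal v (insert x (A \<union> B))"
    by (intro animal.step[where y = b]) auto
  then show ?case by simp
qed

text \<open>Only the site added last is a new root to consider. It is taken as a singleton, to which
  the old animal, rerooted at the neighbour \<open>y\<close>, is attached; this uses that the steps
  are symmetric.\<close>

lemma animal_reroot: "animal v A \<Longrightarrow> u \<in> A \<Longrightarrow> animal u A"
proof (induction arbitrary: u rule: animal.induct)
  case root
  then show ?case using animal.root by auto
next
  case (step A y x)
  show ?case
  proof (cases "u \<in> A")
    case True
    then show ?thesis using step animal.step by blast
  next
    case False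
    then have "u = x" using step by auto
    moreover have "y - x \<in> unit_steps"
      using uminus_unit_steps[OF step.hyps(3)] by simp
    ultimately have "animal u ({u} \<union> A)"
      by (intro animal_Un[OF step.IH[OF step.hyps(2)] animal.root]) auto
    then show ?thesis using \<open>u = x\<close> by simp
  qed
qed

lemma animal_translate: "animal v A \<Longrightarrow> animal (v + w) ((\<lambda>x. x + w) ` A)"
proof (induction rule: animal.induct)
  case (step A y x)
  then have "animal (v + w) (insert (x + w) ((\<lambda>x. x + w) ` A))"
    by (intro animal.step[where y = "y + w"]) auto
  then show ?case by simp
qed (simp add: animal.root)

section \<open>Counting animals by lattice paths\<close>

primrec trail :: "('d::finite) site \<Rightarrow> 'd site list \<Rightarrow> 'd site set" where
  "trail x [] = {x}"
| "trail x (e # es) = insert x (trail (x + e) es)"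

lemma trail_root: "x \<in> trail x es"
  by (cases es) auto

text \<open>Cut the path at its first visit to \<open>y\<close> and insert the step \<open>e\<close>
  and the step back. The path resumes at \<open>y\<close>, so the rest of it is unchanged and the
  only site gained is \<open>y + e\<close>.\<close>

lemma trail_detour:
  assumes "y \<in> trail x es"
  shows "\<exists>es1 es2. es = es1 @ es2 \<and> trail x (es1 @ [e, - e] @ es2) = insert (y + e) (trail x es)"
  using assms
proof (induction es arbitrary: x)
  case Nil
  then show ?case by (auto intro: exI[of _ "[]"])
next
  case (Cons a es)
  show ?case
  proof (cases "y = x")
    case True
    then show ?thesis
      by (intro exI[of _ "[]"] exI[of _ "a # es"]) (auto simp: trail_root)
  next
    case False
    then have "y \<in> trail (x + a) es" using Cons.prems by auto
    from Cons.IH[OF this] obtain es1 es2 where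
      "es = es1 @ es2" "trail (x + a) (es1 @ [e, - e] @ es2) = insert (y + e) (trail (x + a) es)"
      by (elim exE conjE)
    then show ?thesis
      by (intro exI[of _ "a # es1"] exI[of _ es2]) (simp add: insert_commute)
  qed
qed

text \<open>Walking around a spanning tree visits each of its edges twice.\<close>

lemma animal_trail:
  "animal v A \<Longrightarrow> \<exists>es. set es \<subseteq> unit_steps \<and> length es = 2 * (card A - 1) \<and> trail v es = A"
proof (induction rule: animal.induct)
  case root
  then show ?case by (intro exI[of _ "[]"]) auto
next
  case (step A y x)
  then obtain es where es: "set es \<subseteq> unit_steps" "length es = 2 * (card A - 1)" "trail v es = A"
    by auto
  show ?case
  proof (cases "x \<in> A")
    case True
    then show ?thesis using es by (auto simp: insert_absorb)
  next
    case False
    \<comment> \<open>The new site \<open>x\<close> is a leaf attached to \<open>y\<close>; the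
      detour traverses its edge in both directions and so costs two steps.\<close>
    obtain es1 es2 where
      split: "es = es1 @ es2" "trail v (es1 @ [x - y, - (x - y)] @ es2) = insert (y + (x - y)) A"
      using trail_detour[of y v es "x - y"] step es by auto
    have "card A \<noteq> 0" using step.hyps(2) animal_finite[OF step.hyps(1)] by auto
    moreover have "card (insert x A) = Suc (card A)"
      using False animal_finite[OF step.hyps(1)] by simp
    ultimately have "length (es1 @ [x - y, - (x - y)] @ es2) = 2 * (card (insert x A) - 1)"
      using es(2) split(1) by simp
    moreover have "set (es1 @ [x - y, - (x - y)] @ es2) \<subseteq> unit_steps"
      using es(1) split(1) step.hyps(3) uminus_unit_steps[OF step.hyps(3)] by simp
    ultimately show ?thesis
      using split(2) by (intro exI[of _ "es1 @ [x - y, - (x - y)] @ es2"]) simp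
  qed
qed

text \<open>An animal is recovered from a path covering it, so there are at most as many animals of
  size \<open>n\<close> as lists of \<open>2 * (n - 1)\<close> steps. The exponent is rounded up to
  \<open>2 * n\<close> to keep later products simple.\<close>

lemma card_animals:
  fixes v :: "('d::finite) site"
  shows "finite {A. animal v A \<and> card A = n}"
    and "card {A. animal v A \<and> card A = n} \<le> card (unit_steps :: 'd site set) ^ (2 * n)"
proof -
  let ?L = "{es :: 'd site list. set es \<subseteq> unit_steps \<and> length es = 2 * (n - 1)}"
  have sub: "{A. animal v A \<and> card A = n} \<subseteq> trail v ` ?L"
    using animal_trail by blast
  have fin: "finite ?L"
    using finite_lists_length_eq[OF finite_unit_steps] by simp
  show "finite {A. animal v A \<and> card A = n}"
    using sub fin finite_surj by blast
  have "card {A. animal v A \<and> card A = n} \<le> card ?L"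
    using sub fin surj_card_le by blast
  also have "\<dots> = card (unit_steps :: 'd site set) ^ (2 * (n - 1))"
    by (simp add: card_lists_length_eq finite_unit_steps)
  also have "\<dots> \<le> card (unit_steps :: 'd site set) ^ (2 * n)"
    using unit_steps_nonempty finite_unit_steps
    by (intro power_increasing) (auto simp: Suc_le_eq card_gt_0_iff)
  finally show "card {A. animal v A \<and> card A = n} \<le> card (unit_steps :: 'd site set) ^ (2 * n)" .
qed

subsection \<open>The parking dynamics for a regular configuration\<close>

text \<open>The almost sure properties under which the dynamics can be analysed deterministically.
  The last clause rules out ties, for which \<open>parkers\<close> would let no car park.\<close>

definition regular :: "('d::finite) config \<Rightarrow> bool" where
  "regular \<omega> \<longleftrightarrow> (\<forall>v. marker \<omega> v = 1 \<or> marker \<omega> v = -1) \<and>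
     (\<forall>v. walk \<omega> v 0 = v) \<and> (\<forall>v t. walk \<omega> v (Suc t) - walk \<omega> v t \<in> unit_steps) \<and>
     (\<forall>t v w. v \<noteq> w \<longrightarrow> tiebreak \<omega> v t \<noteq> tiebreak \<omega> w t)"

definition vacant :: "('d::finite) config \<Rightarrow> nat \<Rightarrow> 'd site set" where
  "vacant \<omega> t = snd (parking_state \<omega> t)"

text \<open>The index is the time before the move: the car becomes parked at time
  \<open>Suc t\<close>.\<close>

definition parks :: "('d::finite) config \<Rightarrow> nat \<Rightarrow> 'd site \<Rightarrow> 'd site \<Rightarrow> bool" where
  "parks \<omega> t u x \<longleftrightarrow>
     u \<in> parkers \<omega> (Suc t) (unparked \<omega> t) (vacant \<omega> t) \<and> walk \<omega> u (Suc t) = x"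

lemma unparked_0: "unparked \<omega> 0 = {v. marker \<omega> v = 1}"
  by (simp add: unparked_def)

lemma vacant_0: "vacant \<omega> 0 = {v. marker \<omega> v = -1}"
  by (simp add: vacant_def)

lemma unparked_Suc: "unparked \<omega> (Suc t) = {v \<in> unparked \<omega> t. \<forall>x. \<not> parks \<omega> t v x}"
  by (auto simp: unparked_def vacant_def parks_def Let_def split: prod.splits)

lemma vacant_Suc: "vacant \<omega> (Suc t) = {x \<in> vacant \<omega> t. \<forall>v. \<not> parks \<omega> t v x}"
  by (auto simp: unparked_def vacant_def parks_def Let_def split: prod.splits)

lemma unparked_antimono: "s \<le> t \<Longrightarrow> unparked \<omega> t \<subseteq> unparked \<omega> s"
  by (induction rule: dec_induct) (auto simp: unparked_Suc)

lemma parks_imp_unparked: "parks \<omega> t u x \<Longrightarrow> u \<in> unparked \<omega> t"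
  by (auto simp: parks_def parkers_def)

lemma parks_imp_not_unparked: "parks \<omega> s u x \<Longrightarrow> s < t \<Longrightarrow> u \<notin> unparked \<omega> t"
  using unparked_antimono[of "Suc s" t \<omega>] by (auto simp: unparked_Suc)

text \<open>A parked car is never unparked again, so both parking times agree, and then both sites
  are the position of the walk at that time.\<close>

lemma parks_unique:
  assumes "parks \<omega> s u x" "parks \<omega> t u y"
  shows "x = y"
proof (cases s t rule: linorder_cases)
  case equal
  then show ?thesis using assms by (simp add: parks_def)
qed (use assms parks_imp_not_unparked parks_imp_unparked in blast)+

lemma filled_imp_parks:
  "marker \<omega> x = -1 \<Longrightarrow> x \<notin> vacant \<omega> t \<Longrightarrow> \<exists>s<t. \<exists>u. parks \<omega> s u x"
proof (induction t)
  case (Suc t)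
  then show ?case
    by (cases "x \<in> vacant \<omega> t") (auto simp: vacant_Suc less_Suc_eq)
qed (simp add: vacant_0)

text \<open>A walk that is at \<open>x\<close> after \<open>t\<close> steps started at
  \<open>x\<close> minus a sum of \<open>t\<close> unit steps, which leaves finitely many starting
  points. Hence the tie-breaks of the cars arriving together at a site have a maximum.\<close>

lemma finite_walk_preimage:
  assumes "regular \<omega>"
  shows "finite {w. walk \<omega> w t = x}"
proof -
  let ?L = "{es. set es \<subseteq> unit_steps \<and> length es = t}"
  have displacement: "\<exists>es. set es \<subseteq> unit_steps \<and> length es = t \<and> walk \<omega> w t = w + sum_list es" for w
  proof (induction t)
    case 0
    then show ?case using assms by (simp add: regular_def)
  next
    case (Suc t)
    then obtain es where "set es \<subseteq> unit_steps" "length es = t" "walk \<omega> w t = w + sum_list es"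
      by blast
    moreover have "walk \<omega> w (Suc t) - walk \<omega> w t \<in> unit_steps"
      using assms by (simp add: regular_def)
    ultimately show ?case
      by (intro exI[of _ "(walk \<omega> w (Suc t) - walk \<omega> w t) # es"]) simp
  qed
  have "{w. walk \<omega> w t = x} \<subseteq> (\<lambda>es. x - sum_list es) ` ?L"
  proof
    fix w assume "w \<in> {w. walk \<omega> w t = x}"
    with displacement[of w] obtain es where "es \<in> ?L" "x = w + sum_list es" by auto
    then show "w \<in> (\<lambda>es. x - sum_list es) ` ?L" by (intro image_eqI[of _ _ es]) auto
  qed
  then show ?thesis
    by (rule finite_subset) (simp add: finite_lists_length_eq finite_unit_steps)
qed

text \<open>If the spot was still vacant, the arriving car with the largest tie-break takes it:
  finitely many cars arrive, and since tie-breaks are distinct the maximum is strict, as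
  \<open>parkers\<close> demands.\<close>

lemma arrival_fills_spot:
  assumes reg: "regular \<omega>" and v: "v \<in> unparked \<omega> t"
  shows "walk \<omega> v (Suc t) \<notin> vacant \<omega> (Suc t)"
proof (cases "walk \<omega> v (Suc t) \<in> vacant \<omega> t")
  case True
  let ?x = "walk \<omega> v (Suc t)"
  let ?W = "{w \<in> unparked \<omega> t. walk \<omega> w (Suc t) = ?x}"
  have "finite ?W"
    using finite_walk_preimage[OF reg] by (rule rev_finite_subset) auto
  have "?W \<noteq> {}" using v by auto
  then have "Max ((\<lambda>w. tiebreak \<omega> w (Suc t)) ` ?W) \<in> (\<lambda>w. tiebreak \<omega> w (Suc t)) ` ?W"
    using \<open>finite ?W\<close> by (intro Max_in) auto
  then obtain u where u: "u \<in> ?W" "tiebreak \<omega> u (Suc t) = Max ((\<lambda>w. tiebreak \<omega> w (Suc t)) ` ?W)"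
    by (metis (no_types, lifting) imageE)
  have max: "tiebreak \<omega> w (Suc t) \<le> tiebreak \<omega> u (Suc t)" if "w \<in> ?W" for w
    unfolding u(2) using \<open>finite ?W\<close> that by (intro Max_ge) auto
  have "parks \<omega> t u ?x"
    unfolding parks_def parkers_def
  proof (safe intro!: CollectI)
    fix w assume "w \<in> unparked \<omega> t" "w \<noteq> u" "walk \<omega> w (Suc t) = walk \<omega> u (Suc t)"
    then show "tiebreak \<omega> w (Suc t) < tiebreak \<omega> u (Suc t)"
      using u(1) max[of w] reg by (auto simp: regular_def order.strict_iff_order)
  qed (use u True in auto)
  then show ?thesis by (auto simp: vacant_Suc)
qed (simp add: vacant_Suc)

section \<open>Backward exploration of the filled spots\<close>

text \<open>Strong induction on time, for all cars at once. The only new site is the one entered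
  last. If it has a spot, this spot has been filled by a car \<open>u\<close> that was unparked at
  an earlier time, and the set explaining \<open>u\<close> is joined to the one for
  \<open>v\<close>. The bound \<open>s<t\<close> on the parking times will show that no spot was
  filled by \<open>v\<close> itself.\<close>

lemma unparked_explained:
  assumes reg: "regular \<omega>" and "v \<in> unparked \<omega> t"
  shows "\<exists>A. animal v A \<and> (\<forall>s\<le>t. walk \<omega> v s \<in> A) \<and>
    (\<forall>x\<in>A. marker \<omega> x = -1 \<longrightarrow> (\<exists>u\<in>A. \<exists>s<t. parks \<omega> s u x))"
  using assms(2)
proof (induction t arbitrary: v rule: less_induct)
  case (less t)
  show ?case
  proof (cases t)
    case 0
    have "walk \<omega> v 0 = v" using reg by (simp add: regular_def)
    moreover have "marker \<omega> v \<noteq> -1" using 0 less.prems by (simp add: unparked_0)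
    ultimately show ?thesis using 0
      by (intro exI[of _ "{v}"]) (simp add: animal.root)
  next
    case (Suc r)
    let ?x = "walk \<omega> v (Suc r)"
    have "v \<in> unparked \<omega> r" using less.prems Suc by (simp add: unparked_Suc)
    moreover have "r < t" using Suc by simp
    ultimately obtain A where A: "animal v A" "\<forall>s\<le>r. walk \<omega> v s \<in> A"
      "\<forall>x\<in>A. marker \<omega> x = -1 \<longrightarrow> (\<exists>u\<in>A. \<exists>s<r. parks \<omega> s u x)"
      using less.IH[of r v] by (elim meta_impE exE conjE)
    have stp: "?x - walk \<omega> v r \<in> unit_steps" using reg by (simp add: regular_def)
    then have A': "animal v (insert ?x A)"
      using A(1,2) by (intro animal.step[where y = "walk \<omega> v r"]) simp_all
    have trajectory: "\<forall>q\<le>t. walk \<omega> v q \<in> insert ?x A"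
      using A(2) Suc by (simp add: le_Suc_eq)
    show ?thesis
    proof (cases "marker \<omega> ?x = -1")
      case False
      have filled: "\<exists>u\<in>insert ?x A. \<exists>s<t. parks \<omega> s u x" if "x \<in> insert ?x A" "marker \<omega> x = -1" for x
      proof -
        have "x \<in> A" using that False by blast
        then obtain u s where "u \<in> A" "s < r" "parks \<omega> s u x" using A(3) \<open>marker \<omega> x = -1\<close> by blast
        then show ?thesis using Suc by (intro bexI[of _ u] exI[of _ s]) simp_all
      qed
      show ?thesis
        by (rule exI[of _ "insert ?x A"], intro conjI ballI impI) (fact A' trajectory filled)+
    next
      case True
      \<comment> \<open>Whichever car parked there, the arrival of \<open>v\<close> at time
        \<open>t = Suc r\<close> leaves the spot filled.\<close>
      have "?x \<notin> vacant \<omega> t"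
        using arrival_fills_spot[OF reg \<open>v \<in> unparked \<omega> r\<close>] Suc by simp
      with True obtain s u where s: "s < t" "parks \<omega> s u ?x"
        using filled_imp_parks by blast
      have "u \<in> unparked \<omega> s"
        using s(2) by (rule parks_imp_unparked)
      with s(1) obtain B where B: "animal u B" "\<forall>r\<le>s. walk \<omega> u r \<in> B"
        "\<forall>x\<in>B. marker \<omega> x = -1 \<longrightarrow> (\<exists>u\<in>B. \<exists>r<s. parks \<omega> r u x)"
        using less.IH[of s u] by (elim meta_impE exE conjE)
      have "walk \<omega> u (Suc s) - walk \<omega> u s \<in> unit_steps" using reg by (simp add: regular_def)
      from uminus_unit_steps[OF this] have "walk \<omega> u s - ?x \<in> unit_steps"
        using s(2) by (simp add: parks_def)
      \<comment> \<open>Rerooted at the last position of \<open>u\<close> before it parked,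
        \<open>B\<close> is attached to \<open>?x\<close> by the step with which \<open>u\<close>
        entered the spot.\<close>
      moreover have "animal (walk \<omega> u s) B"
        using B(1,2) by (intro animal_reroot[OF B(1)]) simp
      ultimately have animal: "animal v (insert ?x A \<union> B)"
        using A' by (intro animal_Un[where z = ?x]) simp_all
      have filled: "\<exists>w\<in>insert ?x A \<union> B. \<exists>q<t. parks \<omega> q w x"
        if "x \<in> insert ?x A \<union> B" "marker \<omega> x = -1" for x
      proof -
        have "\<exists>q<t. parks \<omega> q u ?x" "u \<in> B" using s animal_root B by auto
        moreover have "\<exists>w\<in>A. \<exists>q<t. parks \<omega> q w x" if xA: "x \<in> A"
        proof -
          obtain w q where "w \<in> A" "q < r" "parks \<omega> q w x" using A(3) \<open>marker \<omega> x = -1\<close> xA by blast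
          then show ?thesis using Suc by (intro bexI[of _ w] exI[of _ q]) simp_all
        qed
        moreover have "\<exists>w\<in>B. \<exists>q<t. parks \<omega> q w x" if xB: "x \<in> B"
        proof -
          obtain w q where "w \<in> B" "q < s" "parks \<omega> q w x" using B(3) \<open>marker \<omega> x = -1\<close> xB by blast
          then show ?thesis using s(1) by (intro bexI[of _ w] exI[of _ q]) simp_all
        qed
        ultimately show ?thesis using that(1) by blast
      qed
      show ?thesis
      proof (rule exI[of _ "insert ?x A \<union> B"], intro conjI ballI impI)
        show "animal v (insert ?x A \<union> B)" by (fact animal)
        show "\<forall>q\<le>t. walk \<omega> v q \<in> insert ?x A \<union> B" using trajectory by blast
      qed (fact filled)
    qed
  qed
qed

text \<open>Map each spot of the explored set to the car that parked there. The map is injective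
  because a car parks at one site only, and it misses \<open>v\<close>, which is still unparked. So
  there are strictly fewer spots than cars.\<close>

lemma unparked_animal:
  assumes reg: "regular \<omega>" and v: "v \<in> unparked \<omega> t"
  shows "\<exists>A. animal v A \<and> (\<forall>s\<le>t. walk \<omega> v s \<in> A) \<and> card A < 2 * card {x\<in>A. marker \<omega> x = 1}"
proof -
  obtain A where A: "animal v A" "\<forall>s\<le>t. walk \<omega> v s \<in> A"
    "\<forall>x\<in>A. marker \<omega> x = -1 \<longrightarrow> (\<exists>u\<in>A. \<exists>s<t. parks \<omega> s u x)"
    using unparked_explained[OF assms] by (elim exE conjE)
  let ?C = "{x\<in>A. marker \<omega> x = 1}" and ?S = "{x\<in>A. marker \<omega> x = -1}"
  have fin: "finite A" using A animal_finite by blast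
  have car: "marker \<omega> u = 1" if "u \<in> unparked \<omega> s" for u s
    using that unparked_antimono[of 0 s \<omega>] by (auto simp: unparked_0)
  have "\<exists>u\<in>?C - {v}. \<exists>s. parks \<omega> s u x" if "x \<in> ?S" for x
  proof -
    from that obtain u s where u: "u \<in> A" "s < t" "parks \<omega> s u x"
      using A(3) by auto
    have "marker \<omega> u = 1"
      using u(3) by (rule car[OF parks_imp_unparked])
    moreover have "u \<noteq> v"
      using parks_imp_not_unparked[OF u(3,2)] v by auto
    ultimately show ?thesis
      using u by (intro bexI[of _ u] exI[of _ s]) simp_all
  qed
  then obtain f where f: "\<And>x. x \<in> ?S \<Longrightarrow> f x \<in> ?C - {v}" "\<And>x. x \<in> ?S \<Longrightarrow> \<exists>s. parks \<omega> s (f x) x"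
    using bchoice[of ?S "\<lambda>x u. u \<in> ?C - {v} \<and> (\<exists>s. parks \<omega> s u x)"] unfolding Bex_def by blast
  have "inj_on f ?S"
  proof (rule inj_onI)
    fix x y assume "x \<in> ?S" "y \<in> ?S" "f x = f y"
    then obtain s t where "parks \<omega> s (f x) x" "parks \<omega> t (f x) y"
      using f(2)[of x] f(2)[of y] by auto
    then show "x = y" by (rule parks_unique)
  qed
  then have "card ?S \<le> card (?C - {v})"
    using f(1) fin by (intro card_inj_on_le[of f]) auto
  moreover have "v \<in> ?C" using car[OF v] animal_root[OF A(1)] by simp
  ultimately have "card ?S < card ?C"
    using fin card_Diff1_less[of ?C v] by simp
  moreover have "A = ?C \<union> ?S" using reg by (auto simp: regular_def)
  then have "card A = card ?C + card ?S"
    using fin card_Un_disjoint[of ?C ?S] by fastforce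
  ultimately show ?thesis using A(1,2) by (intro exI[of _ A]) simp
qed

subsection \<open>Joint law of markers and a walk\<close>

lemma emeasure_marker_pmf_1:
  assumes "p \<in> {0..1}"
  shows "emeasure (measure_pmf (marker_pmf p)) {1} = ennreal p"
proof -
  have "(\<lambda>b. if b then 1 else - 1 :: int) -` {1} = {True}"
    by (auto split: if_splits)
  then have "emeasure (measure_pmf (marker_pmf p)) {1} = emeasure (measure_pmf (bernoulli_pmf p)) {True}"
    by (simp add: marker_pmf_def)
  also have "\<dots> = ennreal p"
    using assms by (simp add: emeasure_pmf_single)
  finally show ?thesis .
qed

lemma space_srw_measure: "space (srw_measure v) = UNIV"
  by (simp add: srw_measure_def space_PiM)

lemma sets_srw_measure: "sets (srw_measure v) = sets (\<Pi>\<^sub>M t\<in>UNIV. count_space UNIV)"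
  by (simp add: srw_measure_def)

lemma space_tiebreak_measure: "space tiebreak_measure = UNIV"
  by (simp add: tiebreak_measure_def space_PiM)

definition site_measure :: "real \<Rightarrow> ('d::finite) site \<Rightarrow> (int \<times> (nat \<Rightarrow> 'd site) \<times> (nat \<Rightarrow> real)) measure" where
  "site_measure p v = measure_pmf (marker_pmf p) \<Otimes>\<^sub>M (srw_measure v \<Otimes>\<^sub>M tiebreak_measure)"

lemma prob_space_site_measure: "prob_space (site_measure p v)"
  unfolding site_measure_def
  by (intro prob_space_pair prob_space_srw_measure prob_space_tiebreak_measure
      measure_pmf.prob_space_axioms)

lemma space_site_measure: "space (site_measure p v) = UNIV"
  by (simp add: site_measure_def space_pair_measure space_srw_measure space_tiebreak_measure)

lemma parking_measure_eq: "parking_measure p = (\<Pi>\<^sub>M v\<in>UNIV. site_measure p v)"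
  by (simp add: parking_measure_def site_measure_def)

lemma emeasure_site_measure_Times:
  assumes "X \<in> sets (srw_measure v)" "Y \<in> sets tiebreak_measure"
  shows "B \<times> X \<times> Y \<in> sets (site_measure p v)"
    and "emeasure (site_measure p v) (B \<times> X \<times> Y) =
      emeasure (measure_pmf (marker_pmf p)) B * (emeasure (srw_measure v) X * emeasure tiebreak_measure Y)"
proof -
  interpret T: prob_space tiebreak_measure by (rule prob_space_tiebreak_measure)
  interpret W: prob_space "srw_measure v \<Otimes>\<^sub>M tiebreak_measure"
    by (intro prob_space_pair prob_space_srw_measure prob_space_tiebreak_measure)
  show "B \<times> X \<times> Y \<in> sets (site_measure p v)"
    using assms by (simp add: site_measure_def)
  show "emeasure (site_measure p v) (B \<times> X \<times> Y) =
      emeasure (measure_pmf (marker_pmf p)) B * (emeasure (srw_measure v) X * emeasure tiebreak_measure Y)"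
    using assms
    by (simp add: site_measure_def W.emeasure_pair_measure_Times T.emeasure_pair_measure_Times)
qed

text \<open>The form in which independence between the sites is used: cylinder events have product
  probability.\<close>

lemma parking_measure_box:
  assumes "finite J" "\<And>v. v \<in> J \<Longrightarrow> X v \<in> sets (site_measure p v)"
  shows "{\<omega>. \<forall>v\<in>J. \<omega> v \<in> X v} \<in> sets (parking_measure p)"
    and "emeasure (parking_measure p) {\<omega>. \<forall>v\<in>J. \<omega> v \<in> X v} = (\<Prod>v\<in>J. emeasure (site_measure p v) (X v))"
proof -
  interpret product_prob_space "site_measure p" UNIV
    by (simp add: product_prob_space_def product_prob_space_axioms_def product_sigma_finite_def
        prob_space_imp_sigma_finite prob_space_site_measure)
  have "{\<omega>. \<forall>v\<in>J. \<omega> v \<in> X v} = prod_emb UNIV (site_measure p) J (Pi\<^sub>E J X)"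
    by (auto simp: prod_emb_def PiE_iff space_site_measure)
  then show "{\<omega>. \<forall>v\<in>J. \<omega> v \<in> X v} \<in> sets (parking_measure p)"
    using assms by (simp add: parking_measure_eq sets_PiM_I)
  have "emeasure (Pi\<^sub>M UNIV (site_measure p)) {x\<in>space (Pi\<^sub>M UNIV (site_measure p)). \<forall>i\<in>J. x i \<in> X i} =
      (\<Prod>v\<in>J. emeasure (site_measure p v) (X v))"
    using assms by (intro emeasure_PiM_Collect) auto
  then show "emeasure (parking_measure p) {\<omega>. \<forall>v\<in>J. \<omega> v \<in> X v} = (\<Prod>v\<in>J. emeasure (site_measure p v) (X v))"
    by (simp add: parking_measure_eq space_PiM space_site_measure)
qed

lemma prod_indicator_power:
  fixes c :: "'a :: comm_monoid_mult"
  assumes "finite J" "F \<subseteq> J"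
  shows "(\<Prod>u\<in>J. if u \<in> F then c else 1) = c ^ card F"
  using assms by (simp add: prod.If_cases Int_absorb1)

text \<open>The markers are independent of the walk of \<open>v\<close> whether or not
  \<open>v \<in> F\<close>, because marker and walk are separate components even at the same
  site.\<close>

lemma emeasure_cars_and_walk:
  fixes v :: "('d::finite) site"
  assumes p: "p \<in> {0..1}" and F: "finite F" and E: "E \<in> sets (srw_measure v)"
  shows "{\<omega>. (\<forall>u\<in>F. marker \<omega> u = 1) \<and> walk \<omega> v \<in> E} \<in> sets (parking_measure p)"
    and "emeasure (parking_measure p) {\<omega>. (\<forall>u\<in>F. marker \<omega> u = 1) \<and> walk \<omega> v \<in> E} =
      ennreal (p ^ card F) * emeasure (srw_measure v) E"
proof -
  define X where "X u = (if u \<in> F then {1 :: int} else UNIV) \<times> (if u = v then E else UNIV) \<times> (UNIV :: (nat \<Rightarrow> real) set)"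
    for u :: "'d site"
  let ?J = "insert v F"
  have eq: "{\<omega>. (\<forall>u\<in>F. marker \<omega> u = 1) \<and> walk \<omega> v \<in> E} = {\<omega>. \<forall>u\<in>?J. \<omega> u \<in> X u}"
    by (auto simp: X_def marker_def walk_def mem_Times_iff split: if_splits)
  have UNIV_srw: "UNIV \<in> sets (srw_measure u)" for u :: "'d site"
    using sets.top[of "srw_measure u"] by (simp add: space_srw_measure)
  have UNIV_tb: "UNIV \<in> sets tiebreak_measure"
    using sets.top[of tiebreak_measure] by (simp add: space_tiebreak_measure)
  have E': "(if u = v then E else UNIV) \<in> sets (srw_measure u)" for u
    using E UNIV_srw by simp
  have X: "X u \<in> sets (site_measure p u)" for u
    unfolding X_def by (rule emeasure_site_measure_Times(1)[OF E' UNIV_tb])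
  have tb: "emeasure tiebreak_measure UNIV = 1"
    using prob_space.emeasure_space_1[OF prob_space_tiebreak_measure] by (simp add: space_tiebreak_measure)
  have srw: "emeasure (srw_measure u) UNIV = 1" for u :: "'d site"
    using prob_space.emeasure_space_1[OF prob_space_srw_measure] by (simp add: space_srw_measure)
  \<comment> \<open>The condition is written \<open>u \<in> {v}\<close> so that
    \<open>prod_indicator_power\<close> evaluates the product of the second factors too, as a first
    power.\<close>
  have "emeasure (site_measure p u) (X u) =
      (if u \<in> F then ennreal p else 1) * (if u \<in> {v} then emeasure (srw_measure v) E else 1)" for u
    unfolding X_def emeasure_site_measure_Times(2)[OF E' UNIV_tb]
    using emeasure_marker_pmf_1[OF p] measure_pmf.emeasure_space_1[of "marker_pmf p"] by (auto simp: tb srw)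
  then have "(\<Prod>u\<in>?J. emeasure (site_measure p u) (X u)) =
      ennreal p ^ card F * emeasure (srw_measure v) E"
    using F prod_indicator_power[of ?J F "ennreal p"] prod_indicator_power[of ?J "{v}" "emeasure (srw_measure v) E"]
    by (simp only: prod.distrib) (simp add: subset_insertI)
  then show "emeasure (parking_measure p) {\<omega>. (\<forall>u\<in>F. marker \<omega> u = 1) \<and> walk \<omega> v \<in> E} =
      ennreal (p ^ card F) * emeasure (srw_measure v) E"
    unfolding eq using F X p parking_measure_box(2)[of ?J X p] by (simp add: ennreal_power)
  show "{\<omega>. (\<forall>u\<in>F. marker \<omega> u = 1) \<and> walk \<omega> v \<in> E} \<in> sets (parking_measure p)"
    unfolding eq using F X by (intro parking_measure_box(1)) auto
qed

section \<open>The walk as a function of its increments\<close>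

definition steps_measure :: "(nat \<Rightarrow> ('d::finite) site) measure" where
  "steps_measure = (\<Pi>\<^sub>M t\<in>UNIV. measure_pmf (pmf_of_set unit_steps))"

text \<open>The walk started at the origin, as a function of the increments;
  \<open>srw_measure v\<close> is the law of its translate by \<open>v\<close>. This realises the
  walks from all starting points on one space.\<close>

definition displacement :: "(nat \<Rightarrow> ('d::finite) site) \<Rightarrow> nat \<Rightarrow> 'd site" where
  "displacement \<xi> t = (\<Sum>s<t. \<xi> s)"

lemma displacement_0: "displacement \<xi> 0 = 0"
  by (simp add: displacement_def)

lemma displacement_Suc: "displacement \<xi> (Suc t) = displacement \<xi> t + \<xi> t"
  by (simp add: displacement_def)

lemma sequence_space_unit_steps: "sequence_space (measure_pmf (pmf_of_set (unit_steps :: ('d::finite) site set)))"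
  by (simp add: sequence_space_def product_prob_space_def product_prob_space_axioms_def
      product_sigma_finite_def measure_pmf.prob_space_axioms prob_space_imp_sigma_finite)

lemma prob_space_steps_measure: "prob_space steps_measure"
  unfolding steps_measure_def by (intro prob_space_PiM measure_pmf.prob_space_axioms)

lemma space_steps_measure: "space steps_measure = UNIV"
  by (simp add: steps_measure_def space_PiM)

lemma measurable_step [measurable]: "(\<lambda>\<xi>. \<xi> t) \<in> steps_measure \<rightarrow>\<^sub>M count_space (UNIV :: ('d::finite) site set)"
  unfolding steps_measure_def
  by (metis UNIV_I measurable_component_singleton measurable_pmf_measure2 sets_measure_pmf_count_space measurable_cong_sets)

lemma measurable_displacement [measurable]: "(\<lambda>\<xi>. displacement \<xi> t) \<in> steps_measure \<rightarrow>\<^sub>M count_space (UNIV :: ('d::finite) site set)"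
proof (induction t)
  case (Suc t)
  have "(\<lambda>(x, y). x + y) \<in> count_space UNIV \<Otimes>\<^sub>M count_space UNIV \<rightarrow>\<^sub>M count_space (UNIV :: 'd site set)"
    by (simp add: pair_measure_countable)
  from measurable_compose[OF measurable_Pair[OF Suc measurable_step] this]
  show ?case by (simp add: displacement_Suc)
qed (simp add: displacement_0)

lemma srw_measure_eq:
  "srw_measure v = distr steps_measure (\<Pi>\<^sub>M t\<in>UNIV. count_space UNIV) (\<lambda>\<xi> t. v + displacement \<xi> t)"
  by (simp add: srw_measure_def steps_measure_def displacement_def)

lemma measurable_walk_from:
  "(\<lambda>\<xi> t. v + displacement \<xi> t) \<in> steps_measure \<rightarrow>\<^sub>M (\<Pi>\<^sub>M t\<in>UNIV. count_space (UNIV :: ('d::finite) site set))"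
proof (rule measurable_PiM_single')
  fix t :: nat
  show "(\<lambda>\<xi>. v + displacement \<xi> t) \<in> steps_measure \<rightarrow>\<^sub>M count_space (UNIV :: 'd site set)"
    by (rule measurable_compose[OF measurable_displacement]) simp
qed auto

text \<open>Seen from its start, a walk from \<open>v\<close> that is at the origin at time
  \<open>n\<close> has displacement \<open>- v\<close>. Only this last condition depends on
  \<open>v\<close>, which prepares the sum over \<open>v\<close>.\<close>

lemma emeasure_srw_translate:
  fixes v :: "('d::finite) site"
  assumes W: "W \<in> sets (\<Pi>\<^sub>M t\<in>UNIV. count_space (UNIV :: 'd site set))"
  shows "{\<xi>. (\<lambda>t. \<xi> t - v) \<in> W \<and> \<xi> n = 0} \<in> sets (srw_measure v)"
    and "emeasure (srw_measure v) {\<xi>. (\<lambda>t. \<xi> t - v) \<in> W \<and> \<xi> n = 0} =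
      emeasure steps_measure {\<xi>. displacement \<xi> \<in> W \<and> displacement \<xi> n = - v}"
proof -
  let ?N = "\<Pi>\<^sub>M t\<in>UNIV. count_space (UNIV :: 'd site set) :: (nat \<Rightarrow> 'd site) measure"
  have comp: "(\<lambda>\<xi>. \<xi> t) \<in> ?N \<rightarrow>\<^sub>M count_space UNIV" for t
    by (rule measurable_component_singleton) simp
  have shift: "(\<lambda>\<xi> t. \<xi> t - v) \<in> ?N \<rightarrow>\<^sub>M ?N"
  proof (rule measurable_PiM_single')
    fix t :: nat
    show "(\<lambda>\<xi>. \<xi> t - v) \<in> ?N \<rightarrow>\<^sub>M count_space UNIV"
      by (rule measurable_compose[OF comp]) simp
  qed auto
  have "(\<lambda>\<xi> t. \<xi> t - v) -` W \<inter> space ?N \<in> sets ?N" "(\<lambda>\<xi>. \<xi> n) -` {0} \<inter> space ?N \<in> sets ?N"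
    using shift comp W by (auto intro!: measurable_sets)
  then have "((\<lambda>\<xi> t. \<xi> t - v) -` W \<inter> space ?N) \<inter> ((\<lambda>\<xi>. \<xi> n) -` {0} \<inter> space ?N) \<in> sets ?N"
    by (rule sets.Int)
  moreover have "((\<lambda>\<xi> t. \<xi> t - v) -` W \<inter> space ?N) \<inter> ((\<lambda>\<xi>. \<xi> n) -` {0} \<inter> space ?N) =
      {\<xi>. (\<lambda>t. \<xi> t - v) \<in> W \<and> \<xi> n = 0}"
    by (auto simp: space_PiM)
  ultimately have sets: "{\<xi>. (\<lambda>t. \<xi> t - v) \<in> W \<and> \<xi> n = 0} \<in> sets ?N" by simp
  then show "{\<xi>. (\<lambda>t. \<xi> t - v) \<in> W \<and> \<xi> n = 0} \<in> sets (srw_measure v)"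
    by (simp add: sets_srw_measure)
  have "v + displacement \<xi> n = 0 \<longleftrightarrow> displacement \<xi> n = - v" for \<xi>
    by (metis add.inverse_inverse add.right_inverse add_left_cancel neg_eq_iff_add_eq_0)
  then show "emeasure (srw_measure v) {\<xi>. (\<lambda>t. \<xi> t - v) \<in> W \<and> \<xi> n = 0} =
      emeasure steps_measure {\<xi>. displacement \<xi> \<in> W \<and> displacement \<xi> n = - v}"
    unfolding srw_measure_eq
    by (subst emeasure_distr[OF measurable_walk_from sets]) (simp add: space_steps_measure vimage_def)
qed

text \<open>A mass transport argument. The set \<open>F\<close> and the path event \<open>W\<close>
  are relative to the start \<open>v\<close>, so their probabilities do not depend on
  \<open>v\<close>. For given increments exactly one start, minus the displacement at time
  \<open>n\<close>, brings the walk to the origin; the events over \<open>v\<close> are thus a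
  partition of the event that the displacement lies in \<open>W\<close>.\<close>

lemma nn_integral_cars_and_walk:
  fixes W :: "(nat \<Rightarrow> ('d::finite) site) set" and n :: nat
  assumes p: "p \<in> {0..1}" and F: "finite F" and W: "W \<in> sets (\<Pi>\<^sub>M t\<in>UNIV. count_space UNIV)"
  defines "event \<equiv> \<lambda>v. {\<omega>. (\<forall>u\<in>F. marker \<omega> (v + u) = 1) \<and> (\<lambda>t. walk \<omega> v t - v) \<in> W \<and> walk \<omega> v n = 0}"
  shows "event v \<in> sets (parking_measure p)"
    and "(\<integral>\<^sup>+v. emeasure (parking_measure p) (event v) \<partial>count_space UNIV) =
      ennreal (p ^ card F) * emeasure steps_measure {\<xi>. displacement \<xi> \<in> W}"
proof -
  let ?E = "\<lambda>v. {\<xi>. (\<lambda>t. \<xi> t - v) \<in> W \<and> \<xi> n = 0}"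
  let ?S = "\<lambda>v. {\<xi>. displacement \<xi> \<in> W \<and> displacement \<xi> n = - v}"
  have event: "event v = {\<omega>. (\<forall>u\<in>(\<lambda>u. v + u) ` F. marker \<omega> u = 1) \<and> walk \<omega> v \<in> ?E v}" for v
    by (auto simp: event_def)
  have F': "finite ((\<lambda>u. v + u) ` F)" "card ((\<lambda>u. v + u) ` F) = card F" for v
    using F by (auto simp: card_image)
  show "event v \<in> sets (parking_measure p)"
    unfolding event by (intro emeasure_cars_and_walk(1) p F' emeasure_srw_translate(1) W)
  have "emeasure (parking_measure p) (event v) = ennreal (p ^ card F) * emeasure steps_measure (?S v)" for v
    unfolding event emeasure_cars_and_walk(2)[OF p F'(1) emeasure_srw_translate(1)[OF W]]
      emeasure_srw_translate(2)[OF W] F'(2) ..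
  then have "(\<integral>\<^sup>+v. emeasure (parking_measure p) (event v) \<partial>count_space UNIV) =
      ennreal (p ^ card F) * (\<integral>\<^sup>+v. emeasure steps_measure (?S v) \<partial>count_space UNIV)"
    by (simp add: nn_integral_cmult)
  also have "(\<integral>\<^sup>+v. emeasure steps_measure (?S v) \<partial>count_space UNIV) = emeasure steps_measure (\<Union>v. ?S v)"
  proof (rule emeasure_UN_countable[symmetric])
    have displacement: "displacement \<in> steps_measure \<rightarrow>\<^sub>M (\<Pi>\<^sub>M t\<in>UNIV. count_space (UNIV :: 'd site set))"
      using measurable_walk_from[of 0] by (simp add: eta_contract_eq)
    show "?S v \<in> sets steps_measure" for v
    proof -
      have "displacement -` W \<inter> space steps_measure \<in> sets steps_measure"
        using displacement W by (rule measurable_sets)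
      moreover have "(\<lambda>\<xi>. displacement \<xi> n) -` {- v} \<inter> space steps_measure \<in> sets steps_measure"
        by (rule measurable_sets[OF measurable_displacement]) simp
      ultimately have "(displacement -` W \<inter> space steps_measure) \<inter> ((\<lambda>\<xi>. displacement \<xi> n) -` {- v} \<inter> space steps_measure)
          \<in> sets steps_measure" by (rule sets.Int)
      then show ?thesis by (simp add: space_steps_measure vimage_def Collect_conj_eq)
    qed
    show "disjoint_family_on ?S UNIV" by (auto simp: disjoint_family_on_def)
  qed simp
  also have "(\<Union>v. ?S v) = {\<xi>. displacement \<xi> \<in> W}"
  proof -
    have "\<xi> \<in> ?S (- displacement \<xi> n)" if "displacement \<xi> \<in> W" for \<xi> using that by simp
    then show ?thesis by blast
  qed
  finally show "(\<integral>\<^sup>+v. emeasure (parking_measure p) (event v) \<partial>count_space UNIV) =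
      ennreal (p ^ card F) * emeasure steps_measure {\<xi>. displacement \<xi> \<in> W}" .
qed

subsection \<open>Exit time of the random walk from a finite set\<close>

definition stays :: "('d::finite) site set \<Rightarrow> nat \<Rightarrow> (nat \<Rightarrow> 'd site) set" where
  "stays A t = {x. \<forall>s\<le>t. x s \<in> A}"

lemma measurable_stays:
  "stays A t \<in> sets (\<Pi>\<^sub>M t\<in>UNIV. count_space (UNIV :: ('d::finite) site set))"
proof -
  let ?N = "\<Pi>\<^sub>M t\<in>UNIV. count_space (UNIV :: 'd site set) :: (nat \<Rightarrow> 'd site) measure"
  have "(\<lambda>x. x s) -` A \<inter> space ?N \<in> sets ?N" for s
    by (rule measurable_sets[OF measurable_component_singleton]) auto
  then have "(\<Inter>s\<in>{..t}. (\<lambda>x. x s) -` A \<inter> space ?N) \<in> sets ?N"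
    by (intro sets.finite_INT) auto
  also have "(\<Inter>s\<in>{..t}. (\<lambda>x. x s) -` A \<inter> space ?N) = stays A t"
    by (auto simp: stays_def space_PiM)
  finally show ?thesis .
qed

lemma sets_displacement_stays: "{\<xi>. displacement \<xi> \<in> stays A t} \<in> sets (steps_measure :: (nat \<Rightarrow> ('d::finite) site) measure)"
proof -
  have "displacement \<in> steps_measure \<rightarrow>\<^sub>M (\<Pi>\<^sub>M t\<in>UNIV. count_space (UNIV :: 'd site set))"
    using measurable_walk_from[of 0] by (simp add: eta_contract_eq)
  from measurable_sets[OF this measurable_stays] show ?thesis
    by (simp add: space_steps_measure vimage_def)
qed

lemma displacement_cong: "(\<And>i. i < t \<Longrightarrow> \<xi> i = \<zeta> i) \<Longrightarrow> displacement \<xi> t = displacement \<zeta> t"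
  by (simp add: displacement_def)

text \<open>Walking straight is the escape route from a finite set used below; its probability
  bounds the chance of escape from below.\<close>

lemma steps_measure_straight:
  fixes e :: "('d::finite) site"
  assumes "e \<in> unit_steps"
  shows "{\<xi>. \<forall>i<n. \<xi> i = e} \<in> sets steps_measure"
    and "measure steps_measure {\<xi>. \<forall>i<n. \<xi> i = e} = (1 / card (unit_steps :: 'd site set)) ^ n"
proof -
  interpret sequence_space "measure_pmf (pmf_of_set (unit_steps :: 'd site set))"
    by (rule sequence_space_unit_steps)
  have eq: "{\<xi>. \<forall>i<n. \<xi> i = e} = prod_emb UNIV (\<lambda>_. measure_pmf (pmf_of_set unit_steps)) {..<n} (Pi\<^sub>E {..<n} (\<lambda>_. {e}))"
    unfolding prod_emb_def set_eq_iff Int_iff vimage_eq restrict_PiE_iff by auto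
  show "{\<xi>. \<forall>i<n. \<xi> i = e} \<in> sets steps_measure"
    unfolding eq steps_measure_def by (intro sets_PiM_I) auto
  show "measure steps_measure {\<xi>. \<forall>i<n. \<xi> i = e} = (1 / card (unit_steps :: 'd site set)) ^ n"
    unfolding eq steps_measure_def
    using assms
    by (subst measure_PiM_emb)
      (simp_all add: measure_pmf_single pmf_of_set[OF unit_steps_nonempty finite_unit_steps])
qed

text \<open>The Markov property at time \<open>t\<close>: gluing two independent increment sequences
  at \<open>t\<close> by \<open>comb_seq\<close> reproduces the law, \<open>P\<close> sees only the
  part before \<open>t\<close>, and \<open>Q\<close> only the part from \<open>t\<close> on.\<close>

lemma steps_measure_split:
  fixes P Q :: "(nat \<Rightarrow> ('d::finite) site) set"
  assumes P: "P \<in> sets steps_measure" and Q: "Q \<in> sets steps_measure"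
    and dep: "\<And>\<xi> \<zeta>. (\<And>i. i < t \<Longrightarrow> \<xi> i = \<zeta> i) \<Longrightarrow> \<xi> \<in> P \<Longrightarrow> \<zeta> \<in> P"
  shows "{\<xi> \<in> P. (\<lambda>i. \<xi> (i + t)) \<in> Q} \<in> sets steps_measure"
    and "measure steps_measure {\<xi> \<in> P. (\<lambda>i. \<xi> (i + t)) \<in> Q} = measure steps_measure P * measure steps_measure Q"
proof -
  interpret S: sequence_space "measure_pmf (pmf_of_set (unit_steps :: 'd site set))"
    by (rule sequence_space_unit_steps)
  interpret prob_space steps_measure by (rule prob_space_steps_measure)
  have comb: "distr (steps_measure \<Otimes>\<^sub>M steps_measure) steps_measure (\<lambda>(\<omega>, \<omega>'). comb_seq t \<omega> \<omega>') =
      (steps_measure :: (nat \<Rightarrow> 'd site) measure)"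
    unfolding steps_measure_def by (rule S.PiM_comb_seq)
  have meas: "(\<lambda>(\<omega>, \<omega>'). comb_seq t \<omega> \<omega>') \<in> steps_measure \<Otimes>\<^sub>M steps_measure \<rightarrow>\<^sub>M
      (steps_measure :: (nat \<Rightarrow> 'd site) measure)"
    unfolding steps_measure_def by (rule measurable_comb_seq)
  let ?R = "{\<xi> \<in> P. (\<lambda>i. \<xi> (i + t)) \<in> Q}"
  have "(\<lambda>\<xi> i. \<xi> (i + t)) \<in> steps_measure \<rightarrow>\<^sub>M (steps_measure :: (nat \<Rightarrow> 'd site) measure)"
    unfolding steps_measure_def
  proof (rule measurable_PiM_single')
    show "(\<lambda>\<xi>. \<xi> (i + t)) \<in> (\<Pi>\<^sub>M t\<in>UNIV. measure_pmf (pmf_of_set unit_steps)) \<rightarrow>\<^sub>M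
        measure_pmf (pmf_of_set (unit_steps :: 'd site set))" for i
      by (rule measurable_component_singleton) simp
  qed (simp add: space_PiM)
  from measurable_sets[OF this Q] have "(\<lambda>\<xi> i. \<xi> (i + t)) -` Q \<in> sets steps_measure"
    by (simp add: space_steps_measure)
  then have "P \<inter> (\<lambda>\<xi> i. \<xi> (i + t)) -` Q \<in> sets steps_measure"
    using P by (rule sets.Int[rotated])
  also have "P \<inter> (\<lambda>\<xi> i. \<xi> (i + t)) -` Q = ?R" by auto
  finally show R: "?R \<in> sets steps_measure" .
  have "comb_seq t \<omega> \<omega>' \<in> P \<longleftrightarrow> \<omega> \<in> P" for \<omega> \<omega>'
    using dep[of "comb_seq t \<omega> \<omega>'" \<omega>] dep[of \<omega> "comb_seq t \<omega> \<omega>'"] by (auto simp: comb_seq_less)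
  then have vim: "(\<lambda>(\<omega>, \<omega>'). comb_seq t \<omega> \<omega>') -` ?R \<inter> space (steps_measure \<Otimes>\<^sub>M steps_measure) = P \<times> Q"
    by (auto simp: comb_seq_add space_pair_measure space_steps_measure)
  have "emeasure steps_measure ?R = emeasure (steps_measure \<Otimes>\<^sub>M steps_measure) (P \<times> Q)"
    using emeasure_distr[OF meas R] unfolding vim comb .
  also have "\<dots> = emeasure steps_measure P * emeasure steps_measure Q"
    by (rule emeasure_pair_measure_Times[OF P Q])
  finally show "measure steps_measure ?R = measure steps_measure P * measure steps_measure Q"
    by (simp add: measure_def enn2real_mult)
qed

text \<open>Multiplication of vectors is componentwise and \<open>of_nat j\<close> is a constant
  vector, so \<open>of_nat j * e\<close> is the multiple of \<open>e\<close> by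
  \<open>j\<close>.\<close>

lemma displacement_straight:
  "(\<And>i. i < n \<Longrightarrow> \<xi> (i + t) = e) \<Longrightarrow> j \<le> n \<Longrightarrow> displacement \<xi> (t + j) = displacement \<xi> t + of_nat j * e"
proof (induction j)
  case (Suc j)
  then have "displacement \<xi> (t + j) = displacement \<xi> t + of_nat j * e" "\<xi> (t + j) = e"
    by (auto simp: add.commute)
  then show ?case by (simp add: displacement_Suc algebra_simps)
qed simp

text \<open>Whatever happened before time \<open>t\<close>, the walk may take its next
  \<open>card A\<close> steps in one fixed direction. It then meets \<open>card A + 1\<close>
  distinct sites and cannot have stayed in \<open>A\<close>.\<close>

lemma stay_prob_decay:
  fixes A :: "('d::finite) site set"
  assumes A: "finite A"
  defines "q \<equiv> \<lambda>t. measure steps_measure {\<xi>. displacement \<xi> \<in> stays A t}"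
  shows "q (t + card A) \<le> (1 - (1 / card (unit_steps :: 'd site set)) ^ card A) * q t"
proof -
  interpret prob_space "steps_measure :: (nat \<Rightarrow> 'd site) measure" by (rule prob_space_steps_measure)
  \<comment> \<open>An arbitrary coordinate direction.\<close>
  obtain i0 :: 'd where True by simp
  define e :: "'d site" where "e = axis i0 1"
  let ?n = "card A"
  let ?P = "\<lambda>t. {\<xi>. displacement \<xi> \<in> stays A t} :: (nat \<Rightarrow> 'd site) set"
  let ?Q = "{\<xi>. \<forall>i<?n. \<xi> i = e} :: (nat \<Rightarrow> 'd site) set"
  let ?R = "{\<xi> \<in> ?P t. (\<lambda>i. \<xi> (i + t)) \<in> ?Q}"
  have e: "e \<in> unit_steps" by (simp add: e_def axis_in_unit_steps)
  have dep: "\<zeta> \<in> ?P t" if "\<And>i. i < t \<Longrightarrow> \<xi> i = \<zeta> i" "\<xi> \<in> ?P t" for \<xi> \<zeta>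
    using that displacement_cong[of _ \<xi> \<zeta>] by (auto simp: stays_def)
  have R: "?R \<in> sets steps_measure"
    by (intro steps_measure_split(1) sets_displacement_stays steps_measure_straight(1) e) (rule dep)
  have "\<xi> \<notin> ?R" if "\<xi> \<in> ?P (t + ?n)" for \<xi>
  proof
    assume "\<xi> \<in> ?R"
    then have line: "displacement \<xi> (t + j) = displacement \<xi> t + of_nat j * e" if "j \<le> ?n" for j
      using that by (intro displacement_straight[of ?n]) auto
    have sub: "(\<lambda>j. displacement \<xi> t + of_nat j * e) ` {..?n} \<subseteq> A"
    proof (intro image_subsetI)
      fix j assume j: "j \<in> {..?n}"
      then have "displacement \<xi> (t + j) \<in> A" using \<open>\<xi> \<in> ?P (t + ?n)\<close> by (simp add: stays_def)
      then show "displacement \<xi> t + of_nat j * e \<in> A" using line[of j] j by simp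
    qed
    \<comment> \<open>The sites on the straight segment differ in coordinate \<open>i0\<close>, and
      there is one more of them than \<open>A\<close> can hold.\<close>
    have "(displacement \<xi> t + of_nat j * e) $ i0 = displacement \<xi> t $ i0 + int j" for j
      by (simp add: e_def axis_def of_nat_index)
    then have "inj_on (\<lambda>j. displacement \<xi> t + of_nat j * e) {..?n}"
      by (intro inj_onI) (metis add_left_cancel of_nat_eq_iff)
    from card_inj_on_le[OF this sub A] show False by simp
  qed
  moreover have "?P (t + ?n) \<subseteq> ?P t" by (auto simp: stays_def)
  ultimately have "?P (t + ?n) \<subseteq> ?P t - ?R" by blast
  then have "q (t + ?n) \<le> measure steps_measure (?P t - ?R)"
    unfolding q_def by (intro finite_measure_mono sets.Diff sets_displacement_stays R)
  also have "\<dots> = q t - measure steps_measure ?R"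
    unfolding q_def by (intro finite_measure_Diff sets_displacement_stays R) auto
  also have "measure steps_measure ?R = q t * (1 / card (unit_steps :: 'd site set)) ^ ?n"
    unfolding q_def steps_measure_straight(2)[OF e, of ?n, symmetric]
    by (intro steps_measure_split(2) sets_displacement_stays steps_measure_straight(1) e) (rule dep)
  finally show ?thesis by (simp add: algebra_simps)
qed

text \<open>By the decay, \<open>c * q t\<close> is at most \<open>q t - q (t + n)\<close>. Summed
  over \<open>t\<close> this telescopes, and what remains is bounded by the first \<open>n\<close>
  terms, each at most 1.\<close>

lemma sum_shift_decay:
  fixes q :: "nat \<Rightarrow> real"
  assumes "0 < c" "\<And>t. 0 \<le> q t" "\<And>t. q t \<le> 1" "\<And>t. q (t + n) \<le> (1 - c) * q t"
  shows "(\<Sum>t<N. q t) \<le> real n / c"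
proof -
  have "c * (\<Sum>t<N. q t) \<le> (\<Sum>t<N. q t - q (t + n))"
    unfolding sum_distrib_left using assms(4) by (intro sum_mono) (simp add: algebra_simps)
  also have "\<dots> = (\<Sum>t<N. q t) - (\<Sum>t\<in>{n..<N + n}. q t)"
    by (simp add: sum_subtractf sum.shift_bounds_nat_ivl[symmetric] atLeast0LessThan[symmetric]
        sum.atLeastLessThan_shift_bounds[of _ 0 n N] comp_def add.commute)
  also have "\<dots> \<le> (\<Sum>t<n. q t)"
  proof -
    have "(\<Sum>t<N. q t) \<le> (\<Sum>t\<in>{..<n} \<union> {n..<N + n}. q t)"
      using assms(2) by (intro sum_mono2) auto
    also have "\<dots> = (\<Sum>t<n. q t) + (\<Sum>t\<in>{n..<N + n}. q t)"
      by (intro sum.union_disjoint) auto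
    finally show ?thesis by simp
  qed
  also have "\<dots> \<le> (\<Sum>t<n. 1)" using assms(3) by (intro sum_mono)
  finally show ?thesis using assms(1) by (simp add: field_simps)
qed

text \<open>The left-hand side is the mean exit time from \<open>A\<close>, as a sum of tail
  probabilities. The decay over blocks of \<open>card A\<close> steps makes it at most exponential
  in \<open>card A\<close>.\<close>

lemma nn_integral_stays:
  fixes A :: "('d::finite) site set"
  assumes A: "finite A"
  shows "(\<integral>\<^sup>+t. emeasure steps_measure {\<xi>. displacement \<xi> \<in> stays A t} \<partial>count_space UNIV) \<le>
    ennreal (card A * card (unit_steps :: 'd site set) ^ card A)"
proof -
  interpret prob_space "steps_measure :: (nat \<Rightarrow> 'd site) measure" by (rule prob_space_steps_measure)
  define K where "K = real (card (unit_steps :: 'd site set))"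
  have K: "K > 0"
    unfolding K_def using unit_steps_nonempty finite_unit_steps by (simp add: card_gt_0_iff)
  define q where "q t = measure steps_measure {\<xi>. displacement \<xi> \<in> stays A t}" for t
  have "(\<Sum>t<N. q t) \<le> card A / (1 / K) ^ card A" for N
    using stay_prob_decay[OF A] K by (intro sum_shift_decay) (auto simp: q_def K_def)
  then have "(\<Sum>t<N. q t) \<le> card A * K ^ card A" for N
    by (simp add: field_simps)
  then have "(\<Sum>t<N. ennreal (q t)) \<le> ennreal (card A * K ^ card A)" for N
    by (subst sum_ennreal) (auto simp: q_def intro: ennreal_leI)
  then have "(\<Sum>t. ennreal (q t)) \<le> ennreal (card A * K ^ card A)"
    by (intro suminf_le_const) auto
  then show ?thesis
    by (simp add: nn_integral_count_space_nat emeasure_eq_measure q_def K_def)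
qed

subsection \<open>Almost every configuration is regular\<close>

lemma AE_pair_fst:
  assumes "prob_space M" "AE x in N. P x"
  shows "AE z in N \<Otimes>\<^sub>M M. P (fst z)"
proof -
  have "AE x in distr (N \<Otimes>\<^sub>M M) N fst. P x"
    using assms(2) by (subst prob_space.distr_pair_fst[OF assms(1)])
  then show ?thesis by (rule AE_distrD[OF measurable_fst])
qed

lemma AE_pair_snd:
  assumes "prob_space M" "AE y in M. P y"
  shows "AE z in N \<Otimes>\<^sub>M M. P (snd z)"
proof -
  interpret prob_space M by fact
  obtain Z where Z: "Z \<in> null_sets M" "{y \<in> space M. \<not> P y} \<subseteq> Z"
    using assms(2) by (auto simp: eventually_ae_filter)
  have "space N \<times> Z \<in> null_sets (N \<Otimes>\<^sub>M M)"
    using Z by (intro times_in_null_sets2) auto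
  then show ?thesis
    by (rule AE_I') (use Z in \<open>auto simp: space_pair_measure\<close>)
qed

lemma AE_parking_measure_component:
  assumes "AE x in site_measure p v. P x"
  shows "AE \<omega> in parking_measure p. P (\<omega> v)"
  unfolding parking_measure_eq using assms prob_space_site_measure by (intro AE_PiM_component) auto

lemma AE_marker: "AE \<omega> in parking_measure p. marker \<omega> v = 1 \<or> marker \<omega> v = -1"
proof -
  have "AE x in measure_pmf (marker_pmf p). x = 1 \<or> x = -1"
    by (auto simp: AE_measure_pmf_iff marker_pmf_def)
  then have "AE x in site_measure p v. fst x = 1 \<or> fst x = -1"
    unfolding site_measure_def
    by (intro AE_pair_fst prob_space_pair prob_space_srw_measure prob_space_tiebreak_measure)
  then show ?thesis
    unfolding marker_def by (rule AE_parking_measure_component)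
qed

lemma AE_srw_measure:
  "AE \<xi> in srw_measure (v :: ('d::finite) site). \<xi> 0 = v \<and> (\<forall>t. \<xi> (Suc t) - \<xi> t \<in> unit_steps)"
proof -
  let ?N = "\<Pi>\<^sub>M t\<in>UNIV. count_space (UNIV :: 'd site set) :: (nat \<Rightarrow> 'd site) measure"
  have comp: "(\<lambda>\<xi>. \<xi> t) \<in> ?N \<rightarrow>\<^sub>M count_space UNIV" for t
    by (rule measurable_component_singleton) simp
  have diff: "(\<lambda>(x, y). x - y) \<in> count_space UNIV \<Otimes>\<^sub>M count_space UNIV \<rightarrow>\<^sub>M count_space (UNIV :: 'd site set)"
    by (simp add: pair_measure_countable)
  have [measurable]: "(\<lambda>\<xi>. \<xi> (Suc t) - \<xi> t) \<in> ?N \<rightarrow>\<^sub>M count_space UNIV" for t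
    using measurable_compose[OF measurable_Pair[OF comp comp] diff] by simp
  note comp[measurable]
  have step: "AE \<xi> in steps_measure. \<xi> t \<in> (unit_steps :: 'd site set)" for t :: nat
    unfolding steps_measure_def
    by (rule AE_PiM_component) (auto simp: measure_pmf.prob_space_axioms AE_measure_pmf_iff
        set_pmf_of_set[OF unit_steps_nonempty finite_unit_steps])
  have "AE \<xi> in steps_measure. \<forall>t. \<xi> t \<in> (unit_steps :: 'd site set)"
    using step by (simp add: AE_all_countable)
  then have "AE \<xi> in steps_measure. v + displacement \<xi> 0 = v \<and>
      (\<forall>t. (v + displacement \<xi> (Suc t)) - (v + displacement \<xi> t) \<in> unit_steps)"
    by (simp add: displacement_0 displacement_Suc)
  then show ?thesis
    unfolding srw_measure_eq by (subst AE_distr_iff[OF measurable_walk_from]) simp_all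
qed

lemma AE_walk:
  "AE \<omega> in parking_measure p. walk \<omega> v 0 = v \<and> (\<forall>t. walk \<omega> v (Suc t) - walk \<omega> v t \<in> unit_steps)"
proof -
  have "AE x in site_measure p v. fst (snd x) 0 = v \<and>
      (\<forall>t. fst (snd x) (Suc t) - fst (snd x) t \<in> unit_steps)"
    unfolding site_measure_def
    by (intro AE_pair_snd AE_pair_fst prob_space_pair prob_space_srw_measure
        prob_space_tiebreak_measure AE_srw_measure)
  then show ?thesis
    unfolding walk_def by (rule AE_parking_measure_component)
qed

section \<open>Almost sure absence of ties\<close>

lemma tiebreak_measure_coordinate:
  assumes "B \<in> sets borel"
  shows "{x. x t \<in> B} \<in> sets tiebreak_measure"
    and "emeasure tiebreak_measure {x. x t \<in> B} = emeasure lborel ({0..1} \<inter> B)"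
proof -
  interpret U: prob_space "uniform_measure lborel {0..1::real}"
    by (rule prob_space_uniform_measure) auto
  interpret product_prob_space "\<lambda>_::nat. uniform_measure lborel {0..1::real}" UNIV ..
  have eq: "{x. x t \<in> B} = {x\<in>space tiebreak_measure. x t \<in> B}"
    by (simp add: space_tiebreak_measure)
  show "emeasure tiebreak_measure {x. x t \<in> B} = emeasure lborel ({0..1} \<inter> B)"
    unfolding eq tiebreak_measure_def using assms
    by (subst emeasure_PiM_Collect_single) (auto simp: divide_ennreal_def)
  show "{x. x t \<in> B} \<in> sets tiebreak_measure"
    unfolding eq tiebreak_measure_def using assms
    by (intro sets_Collect_single) auto
qed

lemma AE_tiebreak_range: "AE \<omega> in parking_measure p. tiebreak \<omega> v t \<in> {0..1}"
proof -
  have "AE x in uniform_measure lborel {0..1::real}. x \<in> {0..1}"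
    by (rule AE_uniform_measureI) auto
  then have "AE x in tiebreak_measure. x t \<in> {0..1}"
    unfolding tiebreak_measure_def
    by (intro AE_PiM_component prob_space_uniform_measure) auto
  then have "AE x in site_measure p v. snd (snd x) t \<in> {0..1}"
    unfolding site_measure_def
    by (intro AE_pair_snd prob_space_pair prob_space_srw_measure prob_space_tiebreak_measure)
  then show ?thesis
    unfolding tiebreak_def by (rule AE_parking_measure_component)
qed

lemma emeasure_two_tiebreaks:
  assumes "v \<noteq> w" "B \<in> sets borel"
  shows "{\<omega>. tiebreak \<omega> v t \<in> B \<and> tiebreak \<omega> w t \<in> B} \<in> sets (parking_measure p)"
    and "emeasure (parking_measure p) {\<omega>. tiebreak \<omega> v t \<in> B \<and> tiebreak \<omega> w t \<in> B} =
      (emeasure lborel ({0..1} \<inter> B))\<^sup>2"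
proof -
  let ?X = "\<lambda>_. UNIV \<times> UNIV \<times> {x. x t \<in> B}"
  have eq: "{\<omega>. tiebreak \<omega> v t \<in> B \<and> tiebreak \<omega> w t \<in> B} = {\<omega>. \<forall>u\<in>{v, w}. \<omega> u \<in> ?X u}"
    by (auto simp: tiebreak_def mem_Times_iff)
  have U: "UNIV \<in> sets (srw_measure u)" for u :: "'a site"
    using sets.top[of "srw_measure u"] by (simp add: space_srw_measure)
  have one: "emeasure (srw_measure u) UNIV = 1" for u :: "'a site"
    using prob_space.emeasure_space_1[OF prob_space_srw_measure] by (simp add: space_srw_measure)
  note X = emeasure_site_measure_Times[OF U tiebreak_measure_coordinate(1)[OF assms(2)]]
  show "{\<omega>. tiebreak \<omega> v t \<in> B \<and> tiebreak \<omega> w t \<in> B} \<in> sets (parking_measure p)"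
    unfolding eq by (intro parking_measure_box(1) X(1)) auto
  have "emeasure (site_measure p u) (?X u) = emeasure lborel ({0..1} \<inter> B)" for u :: "'a site"
    unfolding X(2) tiebreak_measure_coordinate(2)[OF assms(2)] one
    using measure_pmf.emeasure_space_1[of "marker_pmf p"] by simp
  then show "emeasure (parking_measure p) {\<omega>. tiebreak \<omega> v t \<in> B \<and> tiebreak \<omega> w t \<in> B} =
      (emeasure lborel ({0..1} \<inter> B))\<^sup>2"
    unfolding eq using assms(1) X(1)
    by (subst parking_measure_box(2)) (auto simp: power2_eq_square)
qed

text \<open>Cover the unit interval by \<open>m + 2\<close> intervals of length
  \<open>1 / Suc m\<close>. Equal tie-breaks share an interval, which by independence has
  probability at most \<open>(m + 2) / (Suc m)^2\<close>, and this tends to 0.\<close>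

lemma AE_tiebreak_distinct:
  fixes v w :: "('d::finite) site"
  assumes "v \<noteq> w"
  shows "AE \<omega> in parking_measure p. tiebreak \<omega> v t \<noteq> tiebreak \<omega> w t"
proof -
  let ?M = "parking_measure p :: 'd config measure"
  interpret prob_space ?M by (rule prob_space_parking_measure)
  define B where "B m k = {real k / Suc m..(real k + 1) / Suc m}" for m k :: nat
  define E where "E m k = {\<omega> :: 'd config. tiebreak \<omega> v t \<in> B m k \<and> tiebreak \<omega> w t \<in> B m k}" for m k
  define Z where "Z = (\<Inter>m. \<Union>k\<le>Suc m. E m k)"
  have E: "E m k \<in> sets ?M" for m k
    unfolding E_def by (rule emeasure_two_tiebreaks(1)[OF assms]) (simp add: B_def)
  have Z: "Z \<in> sets ?M"
    unfolding Z_def using E by (intro sets.countable_INT sets.finite_UN) auto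
  have bound: "measure ?M Z \<le> 2 * inverse (real (Suc m))" for m
  proof -
    have "emeasure lborel ({0..1} \<inter> B m k) \<le> ennreal (inverse (Suc m))" for k
    proof -
      have "emeasure lborel ({0..1} \<inter> B m k) \<le> emeasure lborel (B m k)"
        by (rule emeasure_mono) (auto simp: B_def)
      also have "\<dots> = ennreal (inverse (Suc m))"
        unfolding B_def by (subst emeasure_lborel_Icc) (simp_all add: field_simps)
      finally show ?thesis .
    qed
    then have "(emeasure lborel ({0..1} \<inter> B m k))\<^sup>2 \<le> (ennreal (inverse (Suc m)))\<^sup>2" for k
      by (intro power_mono) auto
    then have "emeasure ?M (E m k) \<le> ennreal ((inverse (Suc m))\<^sup>2)" for k
      unfolding E_def by (subst emeasure_two_tiebreaks(2)[OF assms]) (auto simp: B_def ennreal_power)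
    then have meas: "measure ?M (E m k) \<le> (inverse (Suc m))\<^sup>2" for k
      by (simp add: emeasure_eq_measure)
    have "measure ?M Z \<le> measure ?M (\<Union>k\<le>Suc m. E m k)"
      using E by (intro finite_measure_mono sets.finite_UN) (auto simp: Z_def)
    also have "\<dots> \<le> (\<Sum>k\<le>Suc m. measure ?M (E m k))"
      using E by (intro finite_measure_subadditive_finite) auto
    also have "\<dots> \<le> (\<Sum>k\<le>Suc m. (inverse (Suc m))\<^sup>2)"
      by (intro sum_mono meas)
    also have "\<dots> = (real m + 2) * (inverse (Suc m))\<^sup>2" by simp
    also have "\<dots> \<le> (2 * real (Suc m)) * (inverse (Suc m))\<^sup>2"
      by (intro mult_right_mono) auto
    also have "\<dots> = 2 * inverse (real (Suc m))"
      by (simp add: power2_eq_square field_simps del: of_nat_Suc)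
    finally show ?thesis .
  qed
  have "measure ?M Z = 0"
  proof (rule ccontr)
    assume "measure ?M Z \<noteq> 0"
    then have "0 < measure ?M Z / 2" by (simp add: zero_less_measure_iff)
    from reals_Archimedean[OF this] obtain m where "inverse (real (Suc m)) < measure ?M Z / 2" ..
    then show False using bound[of m] by simp
  qed
  then have "Z \<in> null_sets ?M"
    using Z by (intro null_setsI) (simp_all add: emeasure_eq_measure)
  then have "AE \<omega> in ?M. \<omega> \<notin> Z" by (rule AE_not_in)
  with AE_tiebreak_range[of v t p] show ?thesis
  proof eventually_elim
    case (elim \<omega>)
    show ?case
    proof
      assume eq: "tiebreak \<omega> v t = tiebreak \<omega> w t"
      define x where "x = tiebreak \<omega> v t"
      have "\<exists>k\<le>Suc m. \<omega> \<in> E m k" for m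
      proof -
        \<comment> \<open>The index of an interval containing \<open>x\<close>. The value
          \<open>Suc m\<close> occurs for \<open>x = 1\<close>, which is why the unions run up to
          \<open>Suc m\<close>.\<close>
        let ?k = "nat \<lfloor>x * Suc m\<rfloor>"
        have x: "0 \<le> x * Suc m" "x * Suc m \<le> Suc m"
          using elim mult_right_mono[of x 1 "Suc m"] by (auto simp: x_def)
        then have "real ?k \<le> x * Suc m" "x * Suc m \<le> real ?k + 1"
          by linarith+
        then have "x \<in> B m ?k" by (simp add: B_def field_simps)
        moreover have "?k \<le> Suc m" using x by linarith
        ultimately show ?thesis using eq by (auto simp: E_def x_def)
      qed
      then have "\<omega> \<in> Z" unfolding Z_def by blast
      with elim show False by simp
    qed
  qed
qed

lemma AE_regular: "AE \<omega> in parking_measure p. regular (\<omega> :: ('d::finite) config)"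
proof -
  have "AE \<omega> in parking_measure p. \<forall>t v w :: 'd site. v \<noteq> w \<longrightarrow> tiebreak \<omega> v t \<noteq> tiebreak \<omega> w t"
    using AE_tiebreak_distinct by (auto simp: AE_all_countable)
  moreover have "AE \<omega> in parking_measure p. \<forall>v :: 'd site. marker \<omega> v = 1 \<or> marker \<omega> v = -1"
    by (simp add: AE_all_countable AE_marker)
  moreover have "AE \<omega> in parking_measure p. \<forall>v :: 'd site. walk \<omega> v 0 = v \<and>
      (\<forall>t. walk \<omega> v (Suc t) - walk \<omega> v t \<in> unit_steps)"
    by (subst AE_all_countable) (intro allI AE_walk)
  ultimately show ?thesis
    by eventually_elim (simp add: regular_def)
qed

subsection \<open>The expected number of visits\<close>

text \<open>The limit of the increasing counts is the number of all pairs of time and car, written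
  as an iterated sum to allow exchanges of order. The index \<open>t\<close> stands for visits at
  time \<open>Suc t\<close>.\<close>

lemma total_visits_eq:
  "total_visits \<omega> =
    (\<integral>\<^sup>+t. \<integral>\<^sup>+v. indicator {v \<in> unparked \<omega> t. walk \<omega> v (Suc t) = 0} v \<partial>count_space UNIV \<partial>count_space UNIV)"
proof -
  let ?D = "\<lambda>t. {(s, v). 1 \<le> s \<and> s \<le> t \<and> v \<in> unparked \<omega> (s - 1) \<and> walk \<omega> v s = 0}"
  let ?X = "{(s, v). 1 \<le> s \<and> v \<in> unparked \<omega> (s - 1) \<and> walk \<omega> v s = 0}"
  let ?T = "{(t, v). v \<in> unparked \<omega> t \<and> walk \<omega> v (Suc t) = 0}"
  have count: "emeasure (count_space UNIV) X = (\<integral>\<^sup>+x. 1 \<partial>count_space X)" for X :: "'b set"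
    by (subst nn_integral_count_space_indicator) simp_all
  have "visits_until \<omega> \<longlonglongrightarrow> emeasure (count_space UNIV) (\<Union>t. ?D t)"
    unfolding visits_until_def by (intro Lim_emeasure_incseq) (auto simp: incseq_def)
  then have "total_visits \<omega> = emeasure (count_space UNIV) (\<Union>t. ?D t)"
    using visits_until_tendsto LIMSEQ_unique by blast
  also have "(\<Union>t. ?D t) = ?X" by auto
  also have "emeasure (count_space UNIV) ?X = (\<integral>\<^sup>+x. 1 \<partial>count_space ?X)"
    by (rule count)
  also have "\<dots> = (\<integral>\<^sup>+x. 1 \<partial>count_space ?T)"
  proof (rule nn_integral_bij_count_space[symmetric])
    show "bij_betw (\<lambda>(t, v). (Suc t, v)) ?T ?X"
      by (rule bij_betw_byWitness[where f' = "\<lambda>(s, v). (s - 1, v)"]) auto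
  qed
  also have "\<dots> = (\<integral>\<^sup>+x. indicator ?T x \<partial>count_space UNIV)"
    by (simp only: count[symmetric] nn_integral_indicator[of ?T "count_space UNIV"] sets_count_space Pow_UNIV UNIV_I)
  also have "\<dots> = (\<integral>\<^sup>+t. \<integral>\<^sup>+v. indicator ?T (t, v) \<partial>count_space UNIV \<partial>count_space UNIV)"
    by (rule nn_integral_fst_count_space[symmetric])
  finally show ?thesis by (simp add: indicator_def)
qed

text \<open>Over a countable index set, measurability at each index gives joint measurability on the
  product with the counting measure.\<close>

lemma borel_measurable_nn_integral_count_space:
  fixes f :: "'i \<Rightarrow> 'a \<Rightarrow> ennreal"
  assumes I: "countable I" and f: "\<And>i. i \<in> I \<Longrightarrow> f i \<in> borel_measurable M"
  shows "(\<lambda>x. \<integral>\<^sup>+i. f i x \<partial>count_space I) \<in> borel_measurable M"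
proof -
  interpret sigma_finite_measure "count_space I"
    using I by (rule sigma_finite_measure_count_space_countable)
  have "(\<lambda>z. f (snd z) (fst z)) \<in> borel_measurable (M \<Otimes>\<^sub>M count_space I)"
  proof (rule measurable_compose_countable'[where f = "\<lambda>i z. f i (fst z)" and g = snd and I = I])
    show "(\<lambda>z. f i (fst z)) \<in> borel_measurable (M \<Otimes>\<^sub>M count_space I)" if "i \<in> I" for i
      by (rule measurable_compose[OF measurable_fst f[OF that]])
  qed (use I in auto)
  then show ?thesis
    by (intro borel_measurable_nn_integral) (simp add: split_beta')
qed

section \<open>Upper bound: union bound over animals\<close>

text \<open>
  Besides its use in the union bound, \<open>trapped_event UNIV {0} 0 v\<close> is the event that the car
  starting at \<open>v\<close> visits the origin at time 1.
\<close>

definition trapped_event ::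
  "('d::finite) site set \<Rightarrow> 'd site set \<Rightarrow> nat \<Rightarrow> 'd site \<Rightarrow> 'd config set" where
  "trapped_event A F t v =
     {\<omega>. (\<forall>u\<in>F. marker \<omega> (v + u) = 1) \<and> (\<lambda>s. walk \<omega> v s - v) \<in> stays A t \<and> walk \<omega> v (Suc t) = 0}"

lemma sets_trapped_event:
  "p \<in> {0..1} \<Longrightarrow> finite F \<Longrightarrow> trapped_event A F t v \<in> sets (parking_measure p)"
  unfolding trapped_event_def by (intro nn_integral_cars_and_walk(1) measurable_stays)

lemma nn_integral_trapped_event:
  "p \<in> {0..1} \<Longrightarrow> finite F \<Longrightarrow>
    (\<integral>\<^sup>+v. emeasure (parking_measure p) (trapped_event A F t v) \<partial>count_space UNIV) =
    ennreal (p ^ card F) * emeasure steps_measure {\<xi>. displacement \<xi> \<in> stays A t}"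
  unfolding trapped_event_def by (intro nn_integral_cars_and_walk(2) measurable_stays)

text \<open>The index set of the union bound, relative to the starting point of the car:
  \<open>A\<close> is the explored set and \<open>F\<close> its set of cars. A walk that has made a
  step occupies two sites, whence \<open>2 \<le> card A\<close>; with the last condition this forces
  \<open>card F \<ge> 2\<close>, the source of the factor \<open>p^2\<close>.\<close>

definition animal_cars :: "(('d::finite) site set \<times> 'd site set) set" where
  "animal_cars = {(A, F). animal 0 A \<and> F \<subseteq> A \<and> 2 \<le> card A \<and> card A < 2 * card F}"

lemma finite_animal_cars: "(A, F) \<in> animal_cars \<Longrightarrow> finite A \<and> finite F"
  using animal_finite finite_subset unfolding animal_cars_def by blast

lemma countable_animal_cars: "countable (animal_cars :: (('d::finite) site set \<times> 'd site set) set)"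
proof (rule countable_subset)
  show "animal_cars \<subseteq> Collect finite \<times> Collect (finite :: 'd site set \<Rightarrow> bool)"
    using finite_animal_cars by auto
qed (simp add: countable_Collect_finite)

text \<open>There are exponentially many shapes \<open>A\<close>, each with at most
  \<open>2 ^ n\<close> choices of a subset \<open>F\<close>.\<close>

lemma card_animal_cars:
  "finite {x \<in> animal_cars. card (fst x :: ('d::finite) site set) = n} \<and>
   card {x \<in> animal_cars. card (fst x :: 'd site set) = n} \<le> card (unit_steps :: 'd site set) ^ (2 * n) * 2 ^ n"
proof -
  let ?N = "{A. animal (0 :: 'd site) A \<and> card A = n}"
  have sub: "{x \<in> animal_cars. card (fst x :: 'd site set) = n} \<subseteq> Sigma ?N Pow"
    by (auto simp: animal_cars_def)
  have fin: "finite (Sigma ?N Pow)"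
    using card_animals(1) animal_finite by (intro finite_SigmaI) auto
  have "card (Sigma ?N Pow) = (\<Sum>A\<in>?N. card (Pow A))"
    using card_animals(1) animal_finite by (intro card_SigmaI) auto
  also have "\<dots> = (\<Sum>A\<in>?N. 2 ^ n)"
    by (intro sum.cong) (auto simp: card_Pow animal_finite)
  also have "\<dots> \<le> card (unit_steps :: 'd site set) ^ (2 * n) * 2 ^ n"
    using card_animals(2)[of "0 :: 'd site" n] by simp
  finally show ?thesis
    using card_mono[OF fin sub] finite_subset[OF sub fin] by linarith
qed

text \<open>Translate the explored set and its cars by \<open>- v\<close>. As \<open>t > 0\<close>,
  the set contains both the start and the first position of the walk, which are distinct.\<close>

lemma unparked_imp_trapped:
  fixes \<omega> :: "('d::finite) config"
  assumes reg: "regular \<omega>" and v: "v \<in> unparked \<omega> t" "walk \<omega> v (Suc t) = 0" and t: "t > 0"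
  shows "\<exists>(A, F)\<in>animal_cars. \<omega> \<in> trapped_event A F t v"
proof -
  obtain A where A: "animal v A" "\<forall>s\<le>t. walk \<omega> v s \<in> A" "card A < 2 * card {x\<in>A. marker \<omega> x = 1}"
    using unparked_animal[OF reg v(1)] by (elim exE conjE)
  define B where "B = (\<lambda>x. x + - v) ` A"
  define F where "F = (\<lambda>x. x + - v) ` {x\<in>A. marker \<omega> x = 1}"
  have fin: "finite A" using A(1) by (rule animal_finite)
  have card: "card B = card A" "card F = card {x\<in>A. marker \<omega> x = 1}"
    unfolding B_def F_def by (intro card_image; simp)+
  have "animal 0 B"
    using animal_translate[OF A(1), of "- v"] by (simp add: B_def)
  moreover have "F \<subseteq> B" by (auto simp: B_def F_def)
  moreover have "2 \<le> card A"
  proof -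
    have "walk \<omega> v (Suc 0) - walk \<omega> v 0 \<in> unit_steps" "walk \<omega> v 0 = v"
      using reg unfolding regular_def by blast+
    then have "walk \<omega> v 1 \<noteq> v" using zero_notin_unit_steps by auto
    moreover have "{v, walk \<omega> v 1} \<subseteq> A"
      using A(2) t animal_root[OF A(1)] by (auto simp: Suc_le_eq)
    ultimately show ?thesis
      using card_mono[OF fin, of "{v, walk \<omega> v 1}"] by simp
  qed
  ultimately have "(B, F) \<in> animal_cars"
    using A(3) by (simp add: animal_cars_def card)
  moreover have "walk \<omega> v s - v \<in> B" if "s \<le> t" for s
    unfolding B_def by (rule image_eqI[of _ _ "walk \<omega> v s"]) (use A(2) that in auto)
  then have "\<omega> \<in> trapped_event B F t v"
    using v(2) by (auto simp: trapped_event_def stays_def F_def)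
  ultimately show ?thesis by blast
qed

lemma total_visits_le:
  fixes \<omega> :: "('d::finite) config"
  assumes reg: "regular \<omega>"
  shows "total_visits \<omega> \<le>
    (\<integral>\<^sup>+v. indicator (trapped_event UNIV {0} 0 v) \<omega> \<partial>count_space UNIV) +
    (\<integral>\<^sup>+x. \<integral>\<^sup>+t. \<integral>\<^sup>+v. indicator (trapped_event (fst x) (snd x) t v) \<omega>
      \<partial>count_space UNIV \<partial>count_space UNIV \<partial>count_space animal_cars)"
proof -
  \<comment> \<open>Index \<open>0\<close>, that is time 1, needs no exploration: every car that
    steps to the origin counts. All later visits are charged to \<open>?b\<close>.\<close>
  let ?a = "\<lambda>t v. indicator (trapped_event UNIV {0} 0 v) \<omega> * indicator {0 :: nat} t :: ennreal"
  let ?b = "\<lambda>x t v. indicator (trapped_event (fst x) (snd x) t v) \<omega> :: ennreal"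
  have "indicator {v \<in> unparked \<omega> t. walk \<omega> v (Suc t) = 0} v \<le>
      ?a t v + (\<integral>\<^sup>+x. ?b x t v \<partial>count_space animal_cars)" for t v
  proof (cases "v \<in> unparked \<omega> t \<and> walk \<omega> v (Suc t) = 0")
    case True
    show ?thesis
    proof (cases "t = 0")
      case True
      with \<open>v \<in> unparked \<omega> t \<and> _\<close> show ?thesis
        by (auto simp: trapped_event_def stays_def unparked_0)
    next
      case False
      then obtain x where x: "x \<in> animal_cars" "\<omega> \<in> trapped_event (fst x) (snd x) t v"
        using unparked_imp_trapped[OF reg, of v t] True by auto
      have "(1 :: ennreal) = (\<integral>\<^sup>+y. indicator {x} y \<partial>count_space animal_cars)"
        using x(1) by (subst nn_integral_indicator) (auto simp: emeasure_count_space)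
      also have "\<dots> \<le> (\<integral>\<^sup>+x. ?b x t v \<partial>count_space animal_cars)"
        using x(2) by (intro nn_integral_mono) (auto simp: indicator_def)
      finally show ?thesis using True by (simp add: add_increasing)
    qed
  next
    case False
    then have "indicator {v \<in> unparked \<omega> t. walk \<omega> v (Suc t) = 0} v = (0 :: ennreal)" by simp
    then show ?thesis by (rule ord_eq_le_trans[OF _ zero_le])
  qed
  then have "total_visits \<omega> \<le> (\<integral>\<^sup>+t. \<integral>\<^sup>+v. ?a t v + (\<integral>\<^sup>+x. ?b x t v \<partial>count_space animal_cars)
      \<partial>count_space UNIV \<partial>count_space UNIV)"
    unfolding total_visits_eq by (intro nn_integral_mono) auto
  also have "\<dots> = (\<integral>\<^sup>+t. \<integral>\<^sup>+v. ?a t v \<partial>count_space UNIV \<partial>count_space UNIV) +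
      (\<integral>\<^sup>+t. \<integral>\<^sup>+v. \<integral>\<^sup>+x. ?b x t v \<partial>count_space animal_cars \<partial>count_space UNIV \<partial>count_space UNIV)"
    by (simp add: nn_integral_add)
  also have "(\<integral>\<^sup>+t. \<integral>\<^sup>+v. ?a t v \<partial>count_space UNIV \<partial>count_space UNIV) =
      (\<integral>\<^sup>+v. indicator (trapped_event UNIV {0} 0 v) \<omega> \<partial>count_space UNIV)"
    by (simp add: nn_integral_multc nn_integral_cmult emeasure_count_space)
  \<comment> \<open>The sum over the pairs \<open>x\<close> is moved outside, so that each pair can
    be estimated on its own.\<close>
  also have "(\<integral>\<^sup>+t. \<integral>\<^sup>+v. \<integral>\<^sup>+x. ?b x t v \<partial>count_space animal_cars \<partial>count_space UNIV \<partial>count_space UNIV) =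
      (\<integral>\<^sup>+t. \<integral>\<^sup>+x. \<integral>\<^sup>+v. ?b x t v \<partial>count_space UNIV \<partial>count_space animal_cars \<partial>count_space UNIV)"
    by (intro nn_integral_cong nn_integral_count_space_nn_integral countable_animal_cars) simp
  also have "\<dots> = (\<integral>\<^sup>+x. \<integral>\<^sup>+t. \<integral>\<^sup>+v. ?b x t v \<partial>count_space UNIV \<partial>count_space UNIV \<partial>count_space animal_cars)"
    by (intro nn_integral_count_space_nn_integral countable_animal_cars) simp
  finally show ?thesis .
qed

text \<open>Take expectations in \<open>total_visits_le\<close>. For each pair, summing over
  \<open>v\<close> removes the condition of being at the origin, and summing over \<open>t\<close>
  then gives the mean exit time. The visits at time 1 contribute exactly \<open>p\<close>.\<close>

lemma expected_visits_le:
  assumes p: "p \<in> {0..1}"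
  defines "K \<equiv> card (unit_steps :: ('d::finite) site set)"
  shows "expected_visits TYPE('d) p \<le> ennreal p +
    (\<integral>\<^sup>+x. ennreal (p ^ card (snd x)) * ennreal (card (fst x) * K ^ card (fst x))
      \<partial>count_space (animal_cars :: ('d site set \<times> 'd site set) set))"
proof -
  let ?M = "parking_measure p :: 'd config measure"
  let ?a = "\<lambda>v. indicator (trapped_event UNIV {0} 0 v) :: 'd config \<Rightarrow> ennreal"
  let ?b = "\<lambda>x t v. indicator (trapped_event (fst x) (snd x) t v) :: 'd config \<Rightarrow> ennreal"
  let ?I = "animal_cars :: ('d site set \<times> 'd site set) set"
  have a: "?a v \<in> borel_measurable ?M" for v
    by (intro borel_measurable_indicator sets_trapped_event p) simp
  have b: "?b x t v \<in> borel_measurable ?M" if "x \<in> ?I" for x t v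
    using that finite_animal_cars[of "fst x" "snd x"]
    by (intro borel_measurable_indicator sets_trapped_event p) simp
  interpret S: prob_space "steps_measure :: (nat \<Rightarrow> 'd site) measure"
    by (rule prob_space_steps_measure)
  note meas = borel_measurable_nn_integral_count_space[where M = ?M]
  note swap = nn_integral_count_space_nn_integral[where M = ?M]
  have "expected_visits TYPE('d) p \<le> (\<integral>\<^sup>+\<omega>. (\<integral>\<^sup>+v. ?a v \<omega> \<partial>count_space UNIV) +
      (\<integral>\<^sup>+x. \<integral>\<^sup>+t. \<integral>\<^sup>+v. ?b x t v \<omega> \<partial>count_space UNIV \<partial>count_space UNIV \<partial>count_space ?I) \<partial>?M)"
    unfolding expected_visits_def
    by (intro nn_integral_mono_AE eventually_mono[OF AE_regular] total_visits_le)
  also have "\<dots> = (\<integral>\<^sup>+\<omega>. \<integral>\<^sup>+v. ?a v \<omega> \<partial>count_space UNIV \<partial>?M) +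
      (\<integral>\<^sup>+\<omega>. \<integral>\<^sup>+x. \<integral>\<^sup>+t. \<integral>\<^sup>+v. ?b x t v \<omega> \<partial>count_space UNIV \<partial>count_space UNIV \<partial>count_space ?I \<partial>?M)"
    by (intro nn_integral_add meas a b countable_animal_cars) simp_all
  also have "(\<integral>\<^sup>+\<omega>. \<integral>\<^sup>+v. ?a v \<omega> \<partial>count_space UNIV \<partial>?M) =
      (\<integral>\<^sup>+v. emeasure ?M (trapped_event UNIV {0} 0 v) \<partial>count_space UNIV)"
    using p by (subst swap) (simp_all add: a sets_trapped_event)
  also have "\<dots> = ennreal p"
    using p S.emeasure_space_1
    by (subst nn_integral_trapped_event) (simp_all add: stays_def space_steps_measure)
  also have "(\<integral>\<^sup>+\<omega>. \<integral>\<^sup>+x. \<integral>\<^sup>+t. \<integral>\<^sup>+v. ?b x t v \<omega> \<partial>count_space UNIV \<partial>count_space UNIV \<partial>count_space ?I \<partial>?M) =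
      (\<integral>\<^sup>+x. \<integral>\<^sup>+\<omega>. \<integral>\<^sup>+t. \<integral>\<^sup>+v. ?b x t v \<omega> \<partial>count_space UNIV \<partial>count_space UNIV \<partial>?M \<partial>count_space ?I)"
    by (intro swap meas b countable_animal_cars) simp_all
  also have "\<dots> \<le> (\<integral>\<^sup>+x. ennreal (p ^ card (snd x)) * ennreal (card (fst x) * K ^ card (fst x)) \<partial>count_space ?I)"
  proof (intro nn_integral_mono)
    fix x assume "x \<in> space (count_space ?I)"
    then have x: "x \<in> ?I" "finite (fst x)" "finite (snd x)"
      using finite_animal_cars[of "fst x" "snd x"] by auto
    have "(\<integral>\<^sup>+\<omega>. \<integral>\<^sup>+t. \<integral>\<^sup>+v. ?b x t v \<omega> \<partial>count_space UNIV \<partial>count_space UNIV \<partial>?M) =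
        (\<integral>\<^sup>+t. \<integral>\<^sup>+\<omega>. \<integral>\<^sup>+v. ?b x t v \<omega> \<partial>count_space UNIV \<partial>?M \<partial>count_space UNIV)"
      by (intro swap meas b x) simp_all
    also have "\<dots> = (\<integral>\<^sup>+t. \<integral>\<^sup>+v. \<integral>\<^sup>+\<omega>. ?b x t v \<omega> \<partial>?M \<partial>count_space UNIV \<partial>count_space UNIV)"
      by (intro nn_integral_cong swap b x) simp_all
    also have "\<dots> = (\<integral>\<^sup>+t. \<integral>\<^sup>+v. emeasure ?M (trapped_event (fst x) (snd x) t v) \<partial>count_space UNIV \<partial>count_space UNIV)"
      using p x by (simp add: sets_trapped_event)
    also have "\<dots> = ennreal (p ^ card (snd x)) *
        (\<integral>\<^sup>+t. emeasure steps_measure {\<xi>. displacement \<xi> \<in> stays (fst x) t} \<partial>count_space UNIV)"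
      by (simp only: nn_integral_trapped_event[OF p x(3)]) (simp add: nn_integral_cmult)
    also have "\<dots> \<le> ennreal (p ^ card (snd x)) * ennreal (card (fst x) * K ^ card (fst x))"
      unfolding K_def by (intro mult_left_mono nn_integral_stays x) simp
    finally show "(\<integral>\<^sup>+\<omega>. \<integral>\<^sup>+t. \<integral>\<^sup>+v. ?b x t v \<omega> \<partial>count_space UNIV \<partial>count_space UNIV \<partial>?M) \<le>
        ennreal (p ^ card (snd x)) * ennreal (card (fst x) * K ^ card (fst x))" .
  qed
  finally show ?thesis by (simp add: add_left_mono)
qed

section \<open>Upper bound: summation over the sizes\<close>

lemma nn_integral_count_by_size:
  fixes h :: "nat \<Rightarrow> ennreal" and f :: "'a \<Rightarrow> nat"
  assumes "\<And>n. finite {x \<in> I. f x = n}" "\<And>n. card {x \<in> I. f x = n} \<le> c n"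
  shows "(\<integral>\<^sup>+x. h (f x) \<partial>count_space I) \<le> (\<Sum>n. of_nat (c n) * h n)"
proof -
  have "(\<integral>\<^sup>+x. h (f x) \<partial>count_space I) =
      (\<integral>\<^sup>+x. \<integral>\<^sup>+n. h n * indicator {y \<in> I. f y = n} x \<partial>count_space UNIV \<partial>count_space I)"
  proof (intro nn_integral_cong)
    fix x assume "x \<in> space (count_space I)"
    then have "(\<integral>\<^sup>+n. h n * indicator {y \<in> I. f y = n} x \<partial>count_space UNIV) =
        (\<integral>\<^sup>+n. h n * indicator {f x} n \<partial>count_space UNIV)"
      by (intro nn_integral_cong) (auto simp: indicator_def)
    then show "h (f x) = (\<integral>\<^sup>+n. h n * indicator {y \<in> I. f y = n} x \<partial>count_space UNIV)"
      by (simp add: nn_integral_indicator_singleton emeasure_count_space)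
  qed
  also have "\<dots> = (\<integral>\<^sup>+n. \<integral>\<^sup>+x. h n * indicator {y \<in> I. f y = n} x \<partial>count_space I \<partial>count_space UNIV)"
    by (rule nn_integral_count_space_nn_integral) auto
  also have "\<dots> = (\<integral>\<^sup>+n. h n * of_nat (card {y \<in> I. f y = n}) \<partial>count_space UNIV)"
    using assms(1) by (intro nn_integral_cong) (simp add: nn_integral_cmult_indicator)
  also have "\<dots> \<le> (\<integral>\<^sup>+n. of_nat (c n) * h n \<partial>count_space UNIV)"
    using assms(2) by (intro nn_integral_mono) (auto simp: mult.commute[of "of_nat _"] intro!: mult_left_mono of_nat_mono)
  also have "\<dots> = (\<Sum>n. of_nat (c n) * h n)" by (rule nn_integral_count_space_nat)
  finally show ?thesis .
qed

text \<open>More than half of the sites of an animal are cars, so up to a constant each site costs a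
  factor of at most \<open>q\<close> when \<open>p \<le> q^2\<close>. For small \<open>q\<close>
  this beats the exponential growth of the number of pairs and of the exit times. Two factors
  \<open>p\<close> are set aside beforehand.\<close>

lemma expected_visits_le_quadratic:
  "\<exists>q>0. \<exists>C. \<forall>p\<in>{0..q}. expected_visits TYPE('d::finite) p \<le> ennreal (p + C * p\<^sup>2)"
proof -
  define K where "K = real (card (unit_steps :: 'd site set))"
  have K: "K \<ge> 1"
    unfolding K_def using unit_steps_nonempty finite_unit_steps by (simp add: Suc_le_eq card_gt_0_iff)
  \<comment> \<open>Makes the ratio of the final geometric series
    \<open>(2 * K^2) * (2 * K * q) = 1 / 2\<close>.\<close>
  define q where "q = 1 / (8 * K ^ 3)"
  have "1 \<le> K ^ 3" using K by (rule one_le_power)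
  then have "1 \<le> 8 * K ^ 3" by linarith
  then have q: "0 < q" "q \<le> 1" using K by (simp_all add: q_def divide_le_eq)
  have "expected_visits TYPE('d) p \<le> ennreal (p + (2 / q ^ 3) * p\<^sup>2)" if p: "p \<in> {0..q\<^sup>2}" for p
  proof -
    have "q\<^sup>2 \<le> 1" using q by (simp add: power_le_one)
    with p have p01: "p \<in> {0..1}" by auto
    \<comment> \<open>Bounds the term of a pair whose animal has \<open>n\<close> sites:
      \<open>q ^ n\<close> comes from the cars, \<open>K ^ n\<close> from the exit time and
      \<open>2 ^ n\<close> from its linear factor \<open>n\<close>.\<close>
    define h where "h n = p\<^sup>2 / q ^ 3 * (2 * K * q) ^ n" for n
    have h0: "0 \<le> h n" for n using K q by (simp add: h_def)
    have term_le: "p ^ k * (real n * K ^ n) \<le> h n" if "2 \<le> n" "n < 2 * k" for n k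
    proof -
      have "k = 2 + (k - 2)" using that by simp
      then have "p ^ k = p ^ (2 + (k - 2))" by (rule arg_cong)
      also have "\<dots> = p\<^sup>2 * p ^ (k - 2)" by (rule power_add)
      also have "\<dots> \<le> p\<^sup>2 * (q\<^sup>2) ^ (k - 2)"
        using p by (intro mult_left_mono power_mono) auto
      \<comment> \<open>The added exponent 3 turns \<open>n < 2 * k\<close> into
        \<open>n \<le> 2 * k - 4 + 3\<close> and avoids a truncated \<open>n - 3\<close>.\<close>
      also have "(q\<^sup>2) ^ (k - 2) = q ^ (2 * k - 4 + 3) / q ^ 3"
        using q by (simp add: power_mult[symmetric] power_add diff_mult_distrib2)
      also have "p\<^sup>2 * (q ^ (2 * k - 4 + 3) / q ^ 3) \<le> p\<^sup>2 * (q ^ n / q ^ 3)"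
        using q that by (intro mult_left_mono divide_right_mono power_decreasing) auto
      finally have "p ^ k \<le> p\<^sup>2 / q ^ 3 * q ^ n" by simp
      moreover have "real n * K ^ n \<le> 2 ^ n * K ^ n"
        using of_nat_less_two_power[of n, where 'a = real] K by (intro mult_right_mono) auto
      ultimately have "p ^ k * (real n * K ^ n) \<le> (p\<^sup>2 / q ^ 3 * q ^ n) * (2 ^ n * K ^ n)"
        using p q K by (intro mult_mono) auto
      also have "\<dots> = h n" by (simp add: h_def power_mult_distrib)
      finally show ?thesis .
    qed
    let ?I = "animal_cars :: ('d site set \<times> 'd site set) set"
    let ?c = "\<lambda>n. card (unit_steps :: 'd site set) ^ (2 * n) * 2 ^ n"
    have "(\<integral>\<^sup>+x. ennreal (p ^ card (snd x)) *
          ennreal (card (fst x) * card (unit_steps :: 'd site set) ^ card (fst x)) \<partial>count_space ?I) \<le>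
        (\<integral>\<^sup>+x. ennreal (h (card (fst x))) \<partial>count_space ?I)"
    proof (intro nn_integral_mono)
      fix x assume "x \<in> space (count_space ?I)"
      then have "2 \<le> card (fst x)" "card (fst x) < 2 * card (snd x)"
        by (auto simp: animal_cars_def)
      from ennreal_leI[OF term_le[OF this]] p
      show "ennreal (p ^ card (snd x)) *
          ennreal (card (fst x) * card (unit_steps :: 'd site set) ^ card (fst x)) \<le> ennreal (h (card (fst x)))"
        by (simp add: ennreal_mult[symmetric] K_def)
    qed
    also have "\<dots> \<le> (\<Sum>n. of_nat (?c n) * ennreal (h n))"
      using card_animal_cars[where 'd = 'd]
      by (intro nn_integral_count_by_size[where f = "\<lambda>x. card (fst x)" and h = "\<lambda>n. ennreal (h n)"]) blast+
    also have "\<dots> = (\<Sum>n. ennreal (p\<^sup>2 / q ^ 3 * (1 / 2) ^ n))"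
    proof (intro suminf_cong)
      fix n
      have "real (?c n) = (2 * K\<^sup>2) ^ n"
        by (simp add: K_def power_mult_distrib mult.commute flip: power_mult)
      then have "real (?c n) * h n = (2 * K\<^sup>2) ^ n * (p\<^sup>2 / q ^ 3 * (2 * K * q) ^ n)"
        by (simp only: h_def)
      also have "\<dots> = p\<^sup>2 / q ^ 3 * ((2 * K\<^sup>2) ^ n * (2 * K * q) ^ n)"
        by (rule mult.left_commute)
      also have "(2 * K\<^sup>2) ^ n * (2 * K * q) ^ n = ((2 * K\<^sup>2) * (2 * K * q)) ^ n"
        by (rule power_mult_distrib[symmetric])
      also have "(2 * K\<^sup>2) * (2 * K * q) = 1 / 2"
        using K by (simp add: q_def field_simps power2_eq_square power3_eq_cube)
      finally show "of_nat (?c n) * ennreal (h n) = ennreal (p\<^sup>2 / q ^ 3 * (1 / 2) ^ n)"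
        using h0 by (metis ennreal_mult ennreal_of_nat_eq_real_of_nat of_nat_0_le_iff)
    qed
    also have "\<dots> = ennreal (2 / q ^ 3 * p\<^sup>2)"
    proof (rule suminf_ennreal_eq)
      have "(\<lambda>n. p\<^sup>2 / q ^ 3 * (1 / 2 :: real) ^ n) sums (p\<^sup>2 / q ^ 3 * (1 / (1 - 1 / 2)))"
        by (intro sums_mult geometric_sums) simp
      then show "(\<lambda>n. p\<^sup>2 / q ^ 3 * (1 / 2 :: real) ^ n) sums (2 / q ^ 3 * p\<^sup>2)" by (simp add: mult.commute)
    qed (use q in simp)
    finally show ?thesis
      using expected_visits_le[OF p01, where 'd = 'd] p q
      by (subst ennreal_plus) (auto intro: order_trans add_left_mono)
  qed
  then show ?thesis using q by (intro exI[of _ "q\<^sup>2"] conjI exI[of _ "2 / q ^ 3"]) auto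
qed

section \<open>Lower bound from the visits at times 1 and 2\<close>

text \<open>A site that held a car never has a spot, so a car whose first step leads there is still
  unparked at time 1, and its arrival at the origin at time 2 is a visit. Visits at later times are
  dropped.\<close>

lemma total_visits_ge:
  fixes \<omega> :: "('d::finite) config"
  shows "(\<integral>\<^sup>+v. indicator (trapped_event UNIV {0} 0 v) \<omega> \<partial>count_space UNIV) +
    (\<Sum>e\<in>unit_steps. \<integral>\<^sup>+v. indicator {\<omega>. (\<forall>u\<in>{0, e}. marker \<omega> (v + u) = 1) \<and>
        (\<lambda>s. walk \<omega> v s - v) \<in> {x. x 1 = e} \<and> walk \<omega> v 2 = 0} \<omega> \<partial>count_space UNIV) \<le> total_visits \<omega>"
proof -
  let ?V = "\<lambda>t v. indicator {v \<in> unparked \<omega> t. walk \<omega> v (Suc t) = 0} v :: ennreal"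
  let ?E = "\<lambda>e v. {\<omega>. (\<forall>u\<in>{0, e}. marker \<omega> (v + u) = 1) \<and>
        (\<lambda>s. walk \<omega> v s - v) \<in> {x. x 1 = e} \<and> walk \<omega> v 2 = 0} :: 'd config set"
  have "indicator (trapped_event UNIV {0} 0 v) \<omega> = ?V 0 v" for v
    by (auto simp: trapped_event_def stays_def unparked_0 indicator_def)
  moreover have "(\<Sum>e\<in>unit_steps. indicator (?E e v) \<omega>) \<le> ?V 1 v" for v
  proof (cases "\<exists>e\<in>unit_steps. \<omega> \<in> ?E e v")
    case True
    then obtain e where e: "e \<in> unit_steps" "\<omega> \<in> ?E e v" by blast
    \<comment> \<open>The first step determines \<open>e\<close>, so at most one summand is
      nonzero.\<close>
    then have "(\<Sum>e\<in>unit_steps. indicator (?E e v) \<omega>) = (\<Sum>e'\<in>unit_steps. if e' = e then 1 else 0 :: ennreal)"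
      by (intro sum.cong) (auto simp: indicator_def)
    also have "\<dots> = 1" using e by (simp add: finite_unit_steps)
    also have "walk \<omega> v (Suc 0) = v + e" using e(2) by (auto simp: algebra_simps)
    then have "v \<in> unparked \<omega> 1"
      using e(2) by (simp add: unparked_Suc unparked_0 parks_def parkers_def vacant_0)
    then have "1 = ?V 1 v" using e(2) by (simp add: numeral_2_eq_2)
    finally show ?thesis by simp
  next
    case False
    then have "(\<Sum>e\<in>unit_steps. indicator (?E e v) \<omega>) = (0 :: ennreal)"
      by (intro sum.neutral) (auto simp: indicator_def)
    then show ?thesis by simp
  qed
  ultimately have "(\<integral>\<^sup>+v. indicator (trapped_event UNIV {0} 0 v) \<omega> \<partial>count_space UNIV) +
      (\<integral>\<^sup>+v. (\<Sum>e\<in>unit_steps. indicator (?E e v) \<omega>) \<partial>count_space UNIV) \<le>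
      (\<integral>\<^sup>+v. ?V 0 v \<partial>count_space UNIV) + (\<integral>\<^sup>+v. ?V 1 v \<partial>count_space UNIV)"
    by (intro add_mono nn_integral_mono) auto
  also have "\<dots> = (\<Sum>t<2. \<integral>\<^sup>+v. ?V t v \<partial>count_space UNIV)"
    by (simp add: numeral_2_eq_2)
  also have "\<dots> \<le> (\<Sum>t. \<integral>\<^sup>+v. ?V t v \<partial>count_space UNIV)"
    by (intro sum_le_suminf) auto
  also have "\<dots> = total_visits \<omega>"
    by (simp add: total_visits_eq nn_integral_count_space_nat)
  finally show ?thesis by (simp add: nn_integral_sum)
qed

text \<open>Time 1 contributes \<open>p\<close>. At time 2 each direction \<open>e\<close>
  contributes \<open>p^2 / K\<close>, with \<open>K\<close> the number of directions: two cars at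
  distinct sites and a prescribed first step. The directions add up to \<open>p^2\<close>.\<close>

lemma expected_visits_ge:
  assumes p: "p \<in> {0..1}"
  shows "ennreal (p + p\<^sup>2) \<le> expected_visits TYPE('d::finite) p"
proof -
  let ?M = "parking_measure p :: 'd config measure"
  let ?S = "steps_measure :: (nat \<Rightarrow> 'd site) measure"
  let ?K = "real (card (unit_steps :: 'd site set))"
  interpret S: prob_space ?S by (rule prob_space_steps_measure)
  let ?E = "\<lambda>e v. {\<omega>. (\<forall>u\<in>{0, e}. marker \<omega> (v + u) = 1) \<and>
        (\<lambda>s. walk \<omega> v s - v) \<in> {x. x 1 = e} \<and> walk \<omega> v 2 = 0} :: 'd config set"
  have W: "{x :: nat \<Rightarrow> 'd site. x 1 = e} \<in> sets (\<Pi>\<^sub>M t\<in>UNIV. count_space UNIV)" for e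
  proof -
    have "(\<lambda>x :: nat \<Rightarrow> 'd site. x 1) -` {e} \<inter> space (\<Pi>\<^sub>M t\<in>UNIV. count_space UNIV) \<in>
        sets (\<Pi>\<^sub>M t\<in>UNIV. count_space UNIV)"
      by (rule measurable_sets[OF measurable_component_singleton]) auto
    then show ?thesis by (simp add: space_PiM vimage_def)
  qed
  have E: "?E e v \<in> sets ?M" for e v
    by (rule nn_integral_cars_and_walk(1)[OF p _ W]) simp
  have T: "trapped_event UNIV {0} 0 v \<in> sets ?M" for v
    using p by (intro sets_trapped_event) simp_all
  note meas = borel_measurable_nn_integral_count_space[where M = ?M]
  note swap = nn_integral_count_space_nn_integral[where M = ?M]
  have second: "(\<integral>\<^sup>+\<omega>. \<integral>\<^sup>+v. indicator (?E e v) \<omega> \<partial>count_space UNIV \<partial>?M) = ennreal (p\<^sup>2 / ?K)"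
    if e: "e \<in> unit_steps" for e
  proof -
    have "(\<integral>\<^sup>+\<omega>. \<integral>\<^sup>+v. indicator (?E e v) \<omega> \<partial>count_space UNIV \<partial>?M) =
        (\<integral>\<^sup>+v. \<integral>\<^sup>+\<omega>. indicator (?E e v) \<omega> \<partial>?M \<partial>count_space UNIV)"
      using E by (intro swap borel_measurable_indicator) auto
    also have "\<dots> = (\<integral>\<^sup>+v. emeasure ?M (?E e v) \<partial>count_space UNIV)"
      by (intro nn_integral_cong nn_integral_indicator E)
    also have "\<dots> = ennreal (p ^ card {0, e}) * emeasure ?S {\<xi>. displacement \<xi> \<in> {x. x 1 = e}}"
      by (rule nn_integral_cars_and_walk(2)[OF p _ W]) simp
    also have "{\<xi>. displacement \<xi> \<in> {x. x 1 = e}} = {\<xi>. \<forall>i<1. \<xi> i = e}"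
      by (auto simp: displacement_def)
    also have "emeasure ?S {\<xi>. \<forall>i<1. \<xi> i = e} = ennreal (1 / ?K)"
      using steps_measure_straight(2)[OF e, of 1] by (simp add: S.emeasure_eq_measure)
    also have "e \<noteq> 0" using e zero_notin_unit_steps by metis
    then have "card {0, e} = 2" by simp
    finally show ?thesis using p by (simp add: ennreal_mult[symmetric])
  qed
  have first: "(\<integral>\<^sup>+\<omega>. \<integral>\<^sup>+v. indicator (trapped_event UNIV {0} 0 v) \<omega> \<partial>count_space UNIV \<partial>?M) = ennreal p"
  proof -
    have "(\<integral>\<^sup>+\<omega>. \<integral>\<^sup>+v. indicator (trapped_event UNIV {0} 0 v) \<omega> \<partial>count_space UNIV \<partial>?M) =
        (\<integral>\<^sup>+v. emeasure ?M (trapped_event UNIV {0} 0 v) \<partial>count_space UNIV)"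
      using T by (subst swap) simp_all
    also have "\<dots> = ennreal p"
      using p S.emeasure_space_1
      by (subst nn_integral_trapped_event) (simp_all add: stays_def space_steps_measure)
    finally show ?thesis .
  qed
  have "?K > 0"
    using unit_steps_nonempty finite_unit_steps by (simp add: card_gt_0_iff)
  then have "ennreal (p + p\<^sup>2) = ennreal p + (\<Sum>e\<in>(unit_steps :: 'd site set). ennreal (p\<^sup>2 / ?K))"
    using p by (subst sum_ennreal) auto
  also have "\<dots> = (\<integral>\<^sup>+\<omega>. (\<integral>\<^sup>+v. indicator (trapped_event UNIV {0} 0 v) \<omega> \<partial>count_space UNIV) +
    (\<Sum>e\<in>unit_steps. \<integral>\<^sup>+v. indicator (?E e v) \<omega> \<partial>count_space UNIV) \<partial>?M)"
  proof (subst nn_integral_add)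
    have meas_E: "(\<lambda>\<omega>. \<integral>\<^sup>+v. indicator (?E e v) \<omega> \<partial>count_space UNIV) \<in> borel_measurable ?M" for e
      using E by (intro meas borel_measurable_indicator) auto
    then show "(\<lambda>\<omega>. \<Sum>e\<in>unit_steps. \<integral>\<^sup>+v. indicator (?E e v) \<omega> \<partial>count_space UNIV) \<in> borel_measurable ?M"
      by (intro borel_measurable_sum)
    show "(\<lambda>\<omega>. \<integral>\<^sup>+v. indicator (trapped_event UNIV {0} 0 v) \<omega> \<partial>count_space UNIV) \<in> borel_measurable ?M"
      using T by (intro meas borel_measurable_indicator) auto
    have "(\<integral>\<^sup>+\<omega>. (\<Sum>e\<in>unit_steps. \<integral>\<^sup>+v. indicator (?E e v) \<omega> \<partial>count_space UNIV) \<partial>?M) =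
        (\<Sum>e\<in>unit_steps. \<integral>\<^sup>+\<omega>. \<integral>\<^sup>+v. indicator (?E e v) \<omega> \<partial>count_space UNIV \<partial>?M)"
      by (intro nn_integral_sum meas_E)
    also have "\<dots> = (\<Sum>e\<in>(unit_steps :: 'd site set). ennreal (p\<^sup>2 / ?K))"
      by (intro sum.cong second refl)
    finally show "ennreal p + (\<Sum>e\<in>(unit_steps :: 'd site set). ennreal (p\<^sup>2 / ?K)) =
        (\<integral>\<^sup>+\<omega>. \<integral>\<^sup>+v. indicator (trapped_event UNIV {0} 0 v) \<omega> \<partial>count_space UNIV \<partial>?M) +
        (\<integral>\<^sup>+\<omega>. (\<Sum>e\<in>unit_steps. \<integral>\<^sup>+v. indicator (?E e v) \<omega> \<partial>count_space UNIV) \<partial>?M)"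
      by (simp only: first)
  qed
  also have "\<dots> \<le> expected_visits TYPE('d) p"
    unfolding expected_visits_def by (intro nn_integral_mono total_visits_ge)
  finally show ?thesis .
qed

text \<open>The finiteness clause ensures that \<open>enn2real\<close> in the expansion loses
  nothing for small \<open>p\<close>.\<close>

theorem theorem1p6:
  "(\<forall>p\<in>{0..1}. ennreal (p + p\<^sup>2) \<le> expected_visits TYPE('d::finite) p) \<and>
   (\<forall>\<^sub>F p in at_right 0. expected_visits TYPE('d) p < \<infinity>) \<and>
   (\<lambda>p. enn2real (expected_visits TYPE('d) p) - p)
     \<in> O[at_right 0](\<lambda>p. p\<^sup>2 * ln (1 / p) powr ((real CARD('d) + 2) / real CARD('d)))"
proof (intro conjI)
  obtain q C where q: "q > 0"
    and upper: "\<And>p. p \<in> {0..q} \<Longrightarrow> expected_visits TYPE('d) p \<le> ennreal (p + C * p\<^sup>2)"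
    using expected_visits_le_quadratic[where 'd = 'd] by blast
  show "\<forall>p\<in>{0..1}. ennreal (p + p\<^sup>2) \<le> expected_visits TYPE('d) p"
    using expected_visits_ge by blast
  \<comment> \<open>Below the threshold \<open>exp (-1)\<close> the logarithm of
    \<open>1 / p\<close> is at least 1, so the quadratic bound implies the bound with the
    logarithmic factor.\<close>
  have "exp (-1 :: real) < 1" by simp
  have small: "\<forall>\<^sub>F p in at_right 0. 0 < p \<and> p < q \<and> p < 1 \<and> p < exp (-1 :: real)"
    using q unfolding eventually_at_right_field
    by (intro exI[of _ "min q (exp (-1))"]) (auto intro: less_trans[OF _ \<open>exp (-1 :: real) < 1\<close>])
  then show "\<forall>\<^sub>F p in at_right 0. expected_visits TYPE('d) p < \<infinity>"
  proof eventually_elim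
    case (elim p)
    then have "expected_visits TYPE('d) p \<le> ennreal (p + C * p\<^sup>2)" by (intro upper) auto
    then show ?case using ennreal_less_top infinity_ennreal_def le_less_trans by metis
  qed
  show "(\<lambda>p. enn2real (expected_visits TYPE('d) p) - p)
      \<in> O[at_right 0](\<lambda>p. p\<^sup>2 * ln (1 / p) powr ((real CARD('d) + 2) / real CARD('d)))"
  proof (rule bigoI[of _ "\<bar>C\<bar>"], use small in eventually_elim)
    case (elim p)
    let ?V = "enn2real (expected_visits TYPE('d) p)"
    have le: "expected_visits TYPE('d) p \<le> ennreal (p + C * p\<^sup>2)" using elim by (intro upper) auto
    have ge: "ennreal (p + p\<^sup>2) \<le> expected_visits TYPE('d) p" using elim by (intro expected_visits_ge) auto
    have fin: "expected_visits TYPE('d) p < top" using le ennreal_less_top le_less_trans by blast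
    then have V: "expected_visits TYPE('d) p = ennreal ?V" by simp
    have "p + p\<^sup>2 \<le> ?V"
      using ord_le_eq_trans[OF ge V] by (rule ennreal_le_iff[THEN iffD1, rotated]) simp
    moreover have "?V \<le> p + C * p\<^sup>2"
    proof -
      \<comment> \<open>The sign of \<open>C\<close> is not known and \<open>ennreal\<close>
        truncates negative numbers to 0; positivity of \<open>?V\<close> lets the comparison pass to
        the reals.\<close>
      have "0 < p + p\<^sup>2" using elim by (simp add: add_pos_pos)
      with \<open>p + p\<^sup>2 \<le> ?V\<close> have "0 < ?V" by linarith
      then show ?thesis using ord_eq_le_trans[OF V[symmetric] le] by (auto simp: ennreal_le_iff2)
    qed
    ultimately have "norm (?V - p) \<le> C * p\<^sup>2" using zero_le_power2[of p] unfolding real_norm_def by linarith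
    also have "\<dots> \<le> \<bar>C\<bar> * (p\<^sup>2 * 1)" by (simp add: mult_right_mono)
    also have "\<dots> \<le> \<bar>C\<bar> * (p\<^sup>2 * ln (1 / p) powr ((real CARD('d) + 2) / real CARD('d)))"
    proof (intro mult_left_mono)
      have "ln p < -1" using elim by (metis exp_gt_zero ln_exp ln_less_cancel_iff)
      then have "1 \<le> ln (1 / p)" using elim by (simp add: ln_div)
      then show "1 \<le> ln (1 / p) powr ((real CARD('d) + 2) / real CARD('d))"
        by (intro ge_one_powr_ge_zero) auto
    qed auto
    finally show ?case by (simp add: abs_mult)
  qed
qed

end
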